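(* Let $P,Q\in\mathbb Z$ with $Q=\pm1$ and $\Delta=P^2+4Q>0$, and assume the Lucas sequence $U_n=U_n(P,Q)$ is nondegenerate. Assume the $abc$ conjecture over $K=\mathbb Q(\sqrt\Delta)$. Fix $A\in\mathbb Z\setminus\{0\}$ and $r\ge1$. Then there exists a constant $C=C(P,Q,A)$, depending only on $P,Q,A$, such that, whenever $n_1,\ldots,n_r$ are pairwise coprime positive integers and $$A y^2=\prod_{i=1}^r U_{n_i}(P,Q)$$ for some $y\in\mathbb Z$, one has $\max_i n_i<C$. In particular, for fixed $A$ and $r$, only finitely many pairwise coprime index $r$-tuples $(n_1,\ldots,n_r)$ can occur.
   Context: The Lucas sequence $U_n=U_n(P,Q)$ is defined by $U_0=0$, $U_1=1$, $U_{n+2}=PU_{n+1}+QU_n$. Let $\alpha,\beta$ be the roots of $x^2-Px-Q$. The sequence is nondegenerate if $\alpha/\beta$ is not a root of unity (then $U_n\neq0$ for $n\ge1$, and $K=\mathbb Q(\sqrt\Delta)$ is a real quadratic field). The $abc$ conjecture over $K$: for every $\varepsilon>0$ there is a constant $C_{K,\varepsilon}$ such that for all triples $(a,b,c)$ of nonzero elements of $K$ with $a+b=c$, $$h(a:b:c)\le(1+\varepsilon)\operatorname{rad}_K(a:b:c)+C_{K,\varepsilon}.$$ Here $h(a:b:c)=\frac1{[K:\mathbb Q]}\sum_v\log\max\{|a|_v,|b|_v,|c|_v\}$, summed over all places $v$ of $K$, with absolute values normalised to satisfy the product formula ($|x|_v=|\sigma(x)|$ for a real embedding $\sigma$, $|x|_{\mathfrak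 p}=(N\mathfrak p)^{-v_{\mathfrak p}(x)}$ for a nonzero prime ideal $\mathfrak p$ of $\mathcal O_K$, $N\mathfrak p=|\mathcal O_K/\mathfrak p|$); and $\operatorname{rad}_K(a:b:c)=\frac1{[K:\mathbb Q]}\sum_{\mathfrak p\in I(a,b,c)}\log N\mathfrak p$, where $I(a,b,c)$ is the set of nonzero prime ideals $\mathfrak p$ for which $v_{\mathfrak p}(a),v_{\mathfrak p}(b),v_{\mathfrak p}(c)$ are not all equal. *)

theory Defs
  imports
    "HOL-Analysis.Infinite_Sum"
    "HOL-Algebra.Algebraic_Closure_Type"
    "HOL-Algebra.Algebra"
begin

section \<open>Lucas sequences\<close>

fun lucas_U :: "int \<Rightarrow> int \<Rightarrow> nat \<Rightarrow> int" where
  "lucas_U P Q 0 = 0"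
| "lucas_U P Q (Suc 0) = 1"
| "lucas_U P Q (Suc (Suc n)) = P * lucas_U P Q (Suc n) + Q * lucas_U P Q n"

definition root_of_unity :: "complex \<Rightarrow> bool" where
  "root_of_unity z \<longleftrightarrow> (\<exists>n>0. z ^ n = 1)"

definition lucas_nondegenerate :: "int \<Rightarrow> int \<Rightarrow> bool" where
  "lucas_nondegenerate P Q \<longleftrightarrow>
     (\<forall>\<alpha> \<beta> :: complex.
        [:- of_int Q, - of_int P, 1:] = [:- \<alpha>, 1:] * [:- \<beta>, 1:] \<longrightarrow> \<not> root_of_unity (\<alpha> / \<beta>))"

section \<open>Prime ideals and valuations of a number field\<close>

text \<open>
  Throughout, \<open>K\<close> is a subfield of the reals of finite degree over the rationals, given by its
  underlying set.  The sum over the infinite places in the height below runs over real embeddings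
  only, so it is the height of the literature for totally real \<open>K\<close>; this covers the real quadratic
  fields to which it is applied.
\<close>

definition quadratic_field :: "int \<Rightarrow> real set" where
  "quadratic_field d = {a + b * sqrt (of_int d) | a b. a \<in> \<rat> \<and> b \<in> \<rat>}"

definition field_ring :: "real set \<Rightarrow> real ring" where
  "field_ring K = ring_of_type_algebra\<lparr>carrier := K\<rparr>"

definition integer_ring :: "real set \<Rightarrow> real ring" where
  "integer_ring K = ring_of_type_algebra\<lparr>carrier := {x \<in> K. algebraic_int x}\<rparr>"

definition field_degree :: "real set \<Rightarrow> nat" where
  "field_degree K = ring.dim (ring_of_type_algebra :: real ring) \<rat> K"

definition finite_places :: "real set \<Rightarrow> real set set" where
  "finite_places K = {\<pp>. primeideal \<pp> (integer_ring K) \<and> \<pp> \<noteq> {0}}"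

text \<open>Extensionality makes each embedding of \<open>K\<close> be counted once, as a function on all reals.\<close>

definition real_embeddings :: "real set \<Rightarrow> (real \<Rightarrow> real) set" where
  "real_embeddings K =
     ring_hom (field_ring K) (ring_of_type_algebra :: real ring) \<inter> extensional K"

definition ideal_norm :: "real set \<Rightarrow> real set \<Rightarrow> nat" where
  "ideal_norm K I = card (carrier (integer_ring K Quot I))"

definition int_valuation :: "real set \<Rightarrow> real set \<Rightarrow> real \<Rightarrow> nat" where
  "int_valuation K \<pp> x = Max {n :: nat. x \<in> \<pp> [^]\<^bsub>ideals_set (integer_ring K)\<^esub> n}"

text \<open>
  Every nonzero element of \<open>K\<close> is a quotient of nonzero integers of \<open>K\<close>; the value does not depend
  on the chosen quotient.  At \<open>x = 0\<close> the value is unspecified.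
\<close>

definition valuation :: "real set \<Rightarrow> real set \<Rightarrow> real \<Rightarrow> int" where
  "valuation K \<pp> x =
     (THE k. \<exists>a b. a \<in> carrier (integer_ring K) - {0} \<and> b \<in> carrier (integer_ring K) - {0} \<and>
        x = a / b \<and> k = int (int_valuation K \<pp> a) - int (int_valuation K \<pp> b))"

definition finite_abs :: "real set \<Rightarrow> real set \<Rightarrow> real \<Rightarrow> real" where
  "finite_abs K \<pp> x = real (ideal_norm K \<pp>) powi (- valuation K \<pp> x)"

section \<open>The abc conjecture\<close>

text \<open>The sum over the finite places has only finitely many nonzero terms.\<close>

definition abc_height :: "real set \<Rightarrow> real \<Rightarrow> real \<Rightarrow> real \<Rightarrow> real" where
  "abc_height K a b c = 1 / real (field_degree K) *
     ((\<Sum>\<sigma>\<in>real_embeddings K. ln (Max {\<bar>\<sigma> a\<bar>, \<bar>\<sigma> b\<bar>, \<bar>\<sigma> c\<bar>})) +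
      (\<Sum>\<^sub>\<infinity>\<pp>\<in>finite_places K. ln (Max {finite_abs K \<pp> a, finite_abs K \<pp> b, finite_abs K \<pp> c})))"

definition abc_places :: "real set \<Rightarrow> real \<Rightarrow> real \<Rightarrow> real \<Rightarrow> real set set" where
  "abc_places K a b c = {\<pp> \<in> finite_places K.
     \<not> (valuation K \<pp> a = valuation K \<pp> b \<and> valuation K \<pp> b = valuation K \<pp> c)}"

definition abc_radical :: "real set \<Rightarrow> real \<Rightarrow> real \<Rightarrow> real \<Rightarrow> real" where
  "abc_radical K a b c = 1 / real (field_degree K) *
     (\<Sum>\<pp>\<in>abc_places K a b c. ln (real (ideal_norm K \<pp>)))"

definition abc_conjecture_over :: "real set \<Rightarrow> bool" where
  "abc_conjecture_over K \<longleftrightarrow>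
     (\<forall>\<epsilon>>0. \<exists>C. \<forall>a\<in>K - {0}. \<forall>b\<in>K - {0}. \<forall>c\<in>K - {0}. a + b = c \<longrightarrow>
        abc_height K a b c \<le> (1 + \<epsilon>) * abc_radical K a b c + C)"

section \<open>Products of Lucas numbers with pairwise coprime indices\<close>

definition admissible_indices :: "int \<Rightarrow> int \<Rightarrow> int \<Rightarrow> nat \<Rightarrow> nat list set" where
  "admissible_indices P Q A r = {ns. length ns = r \<and> (\<forall>i<r. ns ! i > 0) \<and>
     (\<forall>i<r. \<forall>j<r. i \<noteq> j \<longrightarrow> coprime (ns ! i) (ns ! j)) \<and>
     (\<exists>y. A * y\<^sup>2 = (\<Prod>i<r. lucas_U P Q (ns ! i)))}"

end

theory Submission
  imports Defs
begin

text \<open>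
  Write \<open>\<alpha>\<close>, \<open>\<beta>\<close> for the roots of \<open>x\<^sup>2 - P x - Q\<close>, so that
  \<open>(\<alpha> - \<beta>) U\<^sub>n = \<alpha>\<^sup>n - \<beta>\<^sup>n\<close> and \<open>\<alpha> - \<beta>\<close> is a square root of \<open>\<Delta> = P\<^sup>2 + 4 Q\<close>.
  As \<open>Q\<close> is a unit, \<open>gcd (U\<^sub>m, U\<^sub>n) = \<bar>U\<^bsub>gcd (m, n)\<^esub>\<bar>\<close>, so the factors of the product are pairwise
  coprime.  Hence each factor \<open>U\<^sub>n\<close> is a square up to divisors of \<open>A\<close>; all that is used is that a
  prime \<open>p\<close> dividing \<open>U\<^sub>n\<close> satisfies \<open>p\<^sup>2 dvd A\<^sup>2 U\<^sub>n\<close> (lemma \<open>square_dvd_factor\<close>).  So the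
  product of the primes dividing \<open>U\<^sub>n\<close> is at most \<open>\<bar>A\<bar> sqrt \<bar>U\<^sub>n\<bar>\<close>.

  The conjecture is applied, with \<open>\<epsilon> = 1/2\<close>, to \<open>\<alpha>\<^sup>n + (- \<beta>\<^sup>n) = (\<alpha> - \<beta>) U\<^sub>n\<close>.  The two summands are
  units.  With \<open>M = max \<bar>\<alpha>\<bar> \<bar>\<beta>\<bar> > 1\<close>, both real places contribute at least \<open>n ln M\<close> to the height,
  and the finite places contribute nothing negative; the height is at least \<open>n ln M\<close>
  (\<open>abc_height_ge\<close>).  The radical only sees the prime ideals containing \<open>(\<alpha> - \<beta>) U\<^sub>n\<close>.  They lie
  above the rational primes dividing \<open>\<Delta> U\<^sub>n\<close>, and the norms of the prime ideals above \<open>l\<close> have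
  product at most \<open>l\<^sup>2\<close> (\<open>prod_ideal_norm_le\<close>).  So the radical is at most the sum of \<open>ln l\<close> over the
  primes \<open>l\<close> dividing \<open>\<Delta> U\<^sub>n\<close> (\<open>abc_radical_le\<close>), which is at most
  \<open>n ln M / 2\<close> plus a constant depending on \<open>P\<close>, \<open>Q\<close> and \<open>A\<close>.  Comparing,
  \<open>n ln M \<le> 3/4 n ln M + const\<close>, which bounds \<open>n\<close> (\<open>abc_lucas_square_full_bound\<close>).

  Little algebraic number theory is needed.  The ring of integers of a real quadratic
  field has a basis \<open>1, w\<close> over the integers, which leaves at most \<open>l\<^sup>2\<close> residue classes modulo \<open>l\<close>; the
  Chinese remainder theorem turns this into the bound on norms.  Only valuations that vanish have to
  be computed, so unique factorisation of ideals plays no role.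
\<close>

section \<open>Algebraic integers of degree at most two\<close>

hide_const (open) Divisibility.prime

lemma Rats_power2_eq_int:
  fixes x :: real
  assumes "x \<in> \<rat>" "x\<^sup>2 = of_int a * x + of_int b"
  shows "x \<in> \<int>"
proof (rule rational_algebraic_int_is_int[OF _ assms(1)])
  have "poly [:- of_int b, - of_int a, 1:] x = 0"
    using assms(2) by (simp add: power2_eq_square algebra_simps)
  thus "algebraic_int x"
    by (intro algebraic_int.intros[of "[:- of_int b, - of_int a, 1:]"])
       (auto simp: coeff_pCons split: nat.splits)
qed

lemma map_poly_of_int_add:
  "map_poly (of_int :: int \<Rightarrow> 'a::comm_ring_1) (p + q) = map_poly of_int p + map_poly of_int q"
  by (rule poly_eqI) (simp add: coeff_map_poly)

lemma map_poly_of_int_mult: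
  "map_poly (of_int :: int \<Rightarrow> 'a::comm_ring_1) (p * q) = map_poly of_int p * map_poly of_int q"
  by (rule poly_eqI) (simp add: coeff_map_poly coeff_mult)

text \<open>Gauss's lemma for quadratic polynomials: the monic quadratic polynomial over the rationals
  that annihilates an irrational algebraic integer has integral coefficients.\<close>

lemma algebraic_int_quadratic_min_poly:
  fixes x u v :: real
  assumes int: "algebraic_int x" and irr: "x \<notin> \<rat>"
    and uv: "u \<in> \<rat>" "v \<in> \<rat>" and root: "x\<^sup>2 = u * x + v"
  shows "u \<in> \<int> \<and> v \<in> \<int>"
proof -
  let ?f = "map_poly real_of_int"
  obtain p where p: "poly (?f p) x = 0" "lead_coeff p = 1"
    using int by (auto simp: algebraic_int_altdef_ipoly)
  obtain a m where a: "m > 0" "u = of_int a / of_int m"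
    using uv(1) by (metis Rats_cases')
  obtain b k where b: "k > 0" "v = of_int b / of_int k"
    using uv(2) by (metis Rats_cases')
  define q0 where "q0 = [:- b * m, - a * k, m * k:]"
  have q0: "q0 \<noteq> 0" using a b by (simp add: q0_def)
  \<comment> \<open>The primitive integral polynomial proportional to \<open>X\<^sup>2 - u X - v\<close>.\<close>
  define q where "q = primitive_part q0"
  define c where "c = content q0"
  have q0q: "q0 = smult c q" by (simp add: q_def c_def)
  have c0: "c \<noteq> 0" using q0 by (simp add: c_def)
  have cq: "content q = 1" unfolding q_def using q0 by simp
  have degq: "degree q = 2"
    using a b by (simp add: q_def q0_def)
  have "of_int m * of_int k * x\<^sup>2 = of_int a * of_int k * x + of_int b * (of_int m :: real)"
    using root a b by (simp add: field_simps)
  hence "poly (?f q0) x = 0"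
    by (simp add: q0_def power2_eq_square algebra_simps map_poly_pCons)
  moreover have "?f q0 = smult (of_int c) (?f q)"
    by (subst q0q) (simp add: map_poly_smult)
  ultimately have qx: "poly (?f q) x = 0"
    using c0 by simp
  have "q \<noteq> 0" using degq by auto
  obtain s r where sr: "pseudo_divmod p q = (s, r)" by fastforce
  define e where "e = coeff q (degree q) ^ (Suc (degree p) - degree q)"
  have e: "smult e p = q * s + r" and r: "r = 0 \<or> degree r < degree q"
    using pseudo_divmod[OF \<open>q \<noteq> 0\<close> sr] by (auto simp: e_def)
  have "poly (?f (smult e p)) x = poly (?f (q * s)) x + poly (?f r) x"
    unfolding e by (simp add: map_poly_of_int_add)
  hence rx: "poly (?f r) x = 0"
    using p qx by (simp add: map_poly_smult map_poly_of_int_mult)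
  \<comment> \<open>An irrational number is not a root of a nonzero rational polynomial of degree at most one.\<close>
  have "r = 0"
  proof -
    have "degree r \<le> 1" using r degq by auto
    then obtain r0 r1 where r01: "r = [:r0, r1:]"
      by (metis One_nat_def degree_pCons_eq_if degree_eq_zeroE le_Suc_eq le_zero_eq nat.inject pCons_0_0 pCons_cases)
    have *: "of_int r0 + x * of_int r1 = 0"
      using rx by (simp add: r01 map_poly_pCons)
    have "r1 = 0"
    proof (rule ccontr)
      assume "r1 \<noteq> 0"
      hence "x = - of_int r0 / of_int r1" using * by (simp add: field_simps add_eq_0_iff)
      thus False using irr by simp
    qed
    thus ?thesis using * r01 by simp
  qed
  hence eq: "smult e p = q * s" using e by simp
  \<comment> \<open>Comparing contents and leading coefficients, \<open>q\<close> has leading coefficient \<open>1\<close> or \<open>-1\<close>.\<close>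
  have "content p dvd 1"
    using content_dvd_coeff[of p "degree p"] p(2) by simp
  hence cp: "content p = 1" using normalize_content[of p] by simp
  have e0: "e \<noteq> 0" using \<open>q \<noteq> 0\<close> by (simp add: e_def)
  have "content (smult e p) = content (q * s)" using eq by simp
  hence cs: "content s = \<bar>e\<bar>" using cp cq by (simp add: content_mult)
  have "lead_coeff (smult e p) = lead_coeff (q * s)" using eq by simp
  hence "e = lead_coeff q * lead_coeff s" using p(2) e0 by (simp add: lead_coeff_mult)
  moreover have "e dvd lead_coeff s"
    using content_dvd_coeff[of s "degree s"] cs by simp
  ultimately have "lead_coeff q dvd 1"
    using e0 by (metis dvd_def dvd_mult_cancel_left mult.commute mult.right_neutral mult_cancel_left)
  hence lq: "\<bar>coeff q 2\<bar> = 1" using degq by simp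
  have q2: "m * k = c * coeff q 2" and q1: "- a * k = c * coeff q 1" and q0: "- b * m = c * coeff q 0"
    using q0q by (auto simp: q0_def dest: arg_cong[of _ _ "\<lambda>p. coeff p 0"] arg_cong[of _ _ "\<lambda>p. coeff p 1"] arg_cong[of _ _ "\<lambda>p. coeff p 2"] simp: numeral_2_eq_2)
  have sq: "coeff q 2 * coeff q 2 = 1" using lq by (metis abs_mult_self_eq mult_1)
  have "c = m * k * coeff q 2" using q2 sq by (simp add: mult.assoc)
  hence "k * (- a) = k * (m * (coeff q 2 * coeff q 1))" "m * (- b) = m * (k * (coeff q 2 * coeff q 0))"
    using q1 q0 by (simp_all add: ac_simps)
  hence "- a = m * (coeff q 2 * coeff q 1)" "- b = k * (coeff q 2 * coeff q 0)"
    using a(1) b(1) unfolding mult_cancel_left by simp_all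
  hence "real_of_int a = of_int m * of_int (- (coeff q 2 * coeff q 1))"
     "real_of_int b = of_int k * of_int (- (coeff q 2 * coeff q 0))"
    by (metis minus_mult_right minus_minus of_int_mult)+
  hence "u = of_int (- (coeff q 2 * coeff q 1))" "v = of_int (- (coeff q 2 * coeff q 0))"
    using a b by auto
  thus ?thesis by (metis Ints_of_int)
qed

section \<open>Arithmetic of a real quadratic field\<close>

text \<open>A positive integer \<open>d\<close>, not necessarily squarefree, whose square root \<open>s\<close> is irrational, and the
  field \<open>K\<close> generated by \<open>s\<close>.\<close>

locale real_quadratic =
  fixes d :: int
  assumes d_pos: "d > 0" and sqrt_irrational: "sqrt (of_int d) \<notin> \<rat>"
begin

abbreviation "K \<equiv> quadratic_field d"

definition s :: real where "s = sqrt (of_int d)"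

lemma s_square [simp]: "s * s = of_int d"
  using d_pos by (simp add: s_def)

lemma s_irrational: "s \<notin> \<rat>"
  using sqrt_irrational by (simp add: s_def)

lemma K_iff: "x \<in> K \<longleftrightarrow> (\<exists>a\<in>\<rat>. \<exists>b\<in>\<rat>. x = a + b * s)"
  by (auto simp: quadratic_field_def s_def)

lemma K_E:
  assumes "x \<in> K" obtains a b where "a \<in> \<rat>" "b \<in> \<rat>" "x = a + b * s"
  using assms by (auto simp: K_iff)

lemma K_I: "a \<in> \<rat> \<Longrightarrow> b \<in> \<rat> \<Longrightarrow> a + b * s \<in> K"
  unfolding K_iff by blast

lemma coords_unique:
  assumes "a \<in> \<rat>" "b \<in> \<rat>" "a' \<in> \<rat>" "b' \<in> \<rat>" "a + b * s = a' + b' * s"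
  shows "a = a' \<and> b = b'"
proof -
  have "b = b'"
  proof (rule ccontr)
    assume "b \<noteq> b'"
    hence "s = (a' - a) / (b - b')" using assms(5) by (simp add: field_simps)
    thus False using s_irrational assms by simp
  qed
  thus ?thesis using assms(5) by simp
qed

text \<open>The nontrivial automorphism of \<open>K\<close>, sending \<open>s\<close> to \<open>- s\<close>; it is unspecified outside \<open>K\<close>.\<close>

definition galois :: "real \<Rightarrow> real" where
  "galois x = (THE y. \<exists>a\<in>\<rat>. \<exists>b\<in>\<rat>. x = a + b * s \<and> y = a - b * s)"

lemma galois_coords: "a \<in> \<rat> \<Longrightarrow> b \<in> \<rat> \<Longrightarrow> galois (a + b * s) = a - b * s"
  unfolding galois_def by (rule the_equality) (use coords_unique in blast)+

lemma Rats_K: "a \<in> \<rat> \<Longrightarrow> a \<in> K"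
  unfolding K_iff by (rule bexI[of _ a], rule bexI[of _ 0]) auto

lemma s_K: "s \<in> K"
  unfolding K_iff by (rule bexI[of _ 0], rule bexI[of _ 1]) auto

lemma K_add: assumes "x \<in> K" "y \<in> K" shows "x + y \<in> K" "galois (x + y) = galois x + galois y"
proof -
  obtain a b a' b' where *: "a \<in> \<rat>" "b \<in> \<rat>" "x = a + b * s" "a' \<in> \<rat>" "b' \<in> \<rat>" "y = a' + b' * s"
    using assms by (meson K_E)
  have eq: "x + y = (a + a') + (b + b') * s" using * by (simp add: algebra_simps)
  show "x + y \<in> K" unfolding eq using * by (intro K_I) auto
  have "galois ((a + a') + (b + b') * s) = (a + a') - (b + b') * s"
    by (rule galois_coords) (use * in auto)
  thus "galois (x + y) = galois x + galois y"
    unfolding eq using galois_coords[OF *(1,2)] galois_coords[OF *(4,5)] *(3,6)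
    by (simp add: algebra_simps)
qed

lemma K_mult: assumes "x \<in> K" "y \<in> K" shows "x * y \<in> K" "galois (x * y) = galois x * galois y"
proof -
  obtain a b a' b' where *: "a \<in> \<rat>" "b \<in> \<rat>" "x = a + b * s" "a' \<in> \<rat>" "b' \<in> \<rat>" "y = a' + b' * s"
    using assms by (meson K_E)
  have ss: "s * (s * z) = of_int d * z" for z by (metis mult.assoc s_square)
  have eq: "x * y = (a * a' + of_int d * (b * b')) + (a * b' + a' * b) * s"
    using * by (simp add: algebra_simps ss)
  have r: "a * a' + of_int d * (b * b') \<in> \<rat>" "a * b' + a' * b \<in> \<rat>" using * by auto
  show "x * y \<in> K" unfolding eq using r by (rule K_I)
  show "galois (x * y) = galois x * galois y"
    unfolding eq galois_coords[OF r] using * by (simp add: galois_coords algebra_simps ss)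
qed

lemma galois_Rats [simp]: "a \<in> \<rat> \<Longrightarrow> galois a = a"
  using galois_coords[of a 0] by simp

lemma galois_s [simp]: "galois s = - s"
  using galois_coords[of 0 1] by simp

lemma galois_K: assumes "x \<in> K" shows "galois x \<in> K" "galois (galois x) = x"
proof -
  obtain a b where *: "a \<in> \<rat>" "b \<in> \<rat>" "x = a + b * s"
    using assms by (meson K_E)
  have eq: "galois x = a + (- b) * s" using * by (simp add: galois_coords)
  show "galois x \<in> K" unfolding eq using * by (intro K_I) auto
  show "galois (galois x) = x" unfolding eq using * by (subst galois_coords) auto
qed

lemma K_minus: assumes "x \<in> K" shows "- x \<in> K" "galois (- x) = - galois x"
  using K_mult[of "-1" x] assms Rats_K[of "-1"] by auto

lemma galois_eq_0_iff: assumes "x \<in> K" shows "galois x = 0 \<longleftrightarrow> x = 0"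
  using galois_K[OF assms] by (metis galois_Rats Rats_0)

lemma trace_norm_Rats: assumes "x \<in> K" shows "x + galois x \<in> \<rat>" "x * galois x \<in> \<rat>"
proof -
  obtain a b where *: "a \<in> \<rat>" "b \<in> \<rat>" "x = a + b * s"
    using assms by (meson K_E)
  have "x * galois x = a * a - of_int d * (b * b)"
    using * by (simp add: galois_coords algebra_simps flip: s_square)
  moreover have "x + galois x = 2 * a"
    using * by (simp add: galois_coords)
  ultimately show "x + galois x \<in> \<rat>" "x * galois x \<in> \<rat>" using *(1,2) by auto
qed

text \<open>The ring of integers of \<open>K\<close>, as a set of real numbers.  An element of \<open>K\<close> belongs to it if and
  only if its trace and its norm are integers.\<close>

definition OK :: "real set" where "OK = {x \<in> K. algebraic_int x}"

lemma OK_iff: "x \<in> OK \<longleftrightarrow> x \<in> K \<and> x + galois x \<in> \<int> \<and> x * galois x \<in> \<int>"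
proof (intro iffI)
  assume "x \<in> OK"
  hence x: "x \<in> K" "algebraic_int x" by (auto simp: OK_def)
  show "x \<in> K \<and> x + galois x \<in> \<int> \<and> x * galois x \<in> \<int>"
  proof (cases "x \<in> \<rat>")
    case True
    thus ?thesis using rational_algebraic_int_is_int[OF x(2)] x by simp
  next
    case False
    have "x\<^sup>2 = (x + galois x) * x + (- (x * galois x))"
      by (simp add: power2_eq_square algebra_simps)
    from algebraic_int_quadratic_min_poly[OF x(2) False _ _ this] trace_norm_Rats[OF x(1)] x
    show ?thesis by simp
  qed
next
  assume "x \<in> K \<and> x + galois x \<in> \<int> \<and> x * galois x \<in> \<int>"
  hence x: "x \<in> K" "x + galois x \<in> \<int>" "x * galois x \<in> \<int>" by auto
  have "algebraic_int x"
    using x(2,3)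
    by (intro algebraic_int.intros[of "[:x * galois x, - (x + galois x), 1:]"])
       (auto simp: coeff_pCons algebra_simps split: nat.splits simp del: minus_add_distrib)
  thus "x \<in> OK" using x by (simp add: OK_def)
qed

lemma Ints_OK: "x \<in> \<int> \<Longrightarrow> x \<in> OK"
  using Rats_K[of x] by (simp add: OK_def int_imp_algebraic_int Ints_subset_Rats[THEN subsetD])

lemma OK_Rats: "x \<in> OK \<Longrightarrow> x \<in> \<rat> \<Longrightarrow> x \<in> \<int>"
  by (simp add: OK_def rational_algebraic_int_is_int)

lemma s_OK: "s \<in> OK"
  by (simp add: OK_iff s_K)

lemma OK_K: "x \<in> OK \<Longrightarrow> x \<in> K" by (simp add: OK_def)

lemma galois_OK: "x \<in> OK \<Longrightarrow> galois x \<in> OK"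
  by (simp add: OK_iff galois_K add.commute mult.commute)

text \<open>The rational number \<open>t = x y + x' y'\<close>, with primes for conjugates, is an integer because it is a
  root of a monic integral quadratic polynomial: its second root is \<open>t' = x y' + x' y\<close>, where \<open>t + t'\<close>
  is the product of the traces of \<open>x\<close> and \<open>y\<close>, and \<open>t t'\<close> is integral in traces and norms.  This makes
  \<open>OK\<close> closed under addition and multiplication.\<close>

lemma mixed_trace_Ints:
  assumes "x \<in> OK" "y \<in> OK" shows "x * y + galois x * galois y \<in> \<int>"
proof -
  define t where "t = x * y + galois x * galois y"
  define t' where "t' = x * galois y + galois x * y"
  have K: "x \<in> K" "y \<in> K" using assms OK_K by auto
  obtain tx nx ty ny where i: "x + galois x = of_int tx" "x * galois x = of_int nx"
     "y + galois y = of_int ty" "y * galois y = of_int ny"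
    using assms unfolding OK_iff by (auto elim!: Ints_cases)
  have 1: "t' = of_int (tx * ty) - t"
    unfolding t_def t'_def of_int_mult by (simp flip: i add: algebra_simps)
  have "t * t' = of_int (ny * (tx * tx - 2 * nx) + nx * (ty * ty - 2 * ny))"
    unfolding t_def t'_def of_int_mult of_int_add of_int_diff of_int_numeral by (simp flip: i add: algebra_simps)
  hence "t\<^sup>2 = of_int (tx * ty) * t + of_int (- (ny * (tx * tx - 2 * nx) + nx * (ty * ty - 2 * ny)))"
    unfolding 1 of_int_minus by (simp add: power2_eq_square algebra_simps)
  moreover have "t \<in> \<rat>"
    using trace_norm_Rats(1)[OF K_mult(1)[OF K]] K_mult(2)[OF K] by (simp add: t_def)
  ultimately show ?thesis using Rats_power2_eq_int t_def by blast
qed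

lemma OK_add: assumes "x \<in> OK" "y \<in> OK" shows "x + y \<in> OK"
proof -
  have K: "x \<in> K" "y \<in> K" using assms OK_K by auto
  have "(x + y) * galois (x + y) = x * galois x + y * galois y + (x * galois y + galois x * galois (galois y))"
    using K by (simp add: K_add galois_K algebra_simps)
  moreover have "x * galois y + galois x * galois (galois y) \<in> \<int>"
    using mixed_trace_Ints[OF assms(1) galois_OK[OF assms(2)]] .
  moreover have "x + y + galois (x + y) = (x + galois x) + (y + galois y)" using K by (simp add: K_add)
  ultimately show ?thesis using assms unfolding OK_iff by (metis Ints_add K_add(1))
qed

lemma OK_mult: assumes "x \<in> OK" "y \<in> OK" shows "x * y \<in> OK"
proof -
  have K: "x \<in> K" "y \<in> K" using assms OK_K by auto
  have "(x * y) * galois (x * y) = (x * galois x) * (y * galois y)"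
    using K by (simp add: K_mult)
  thus ?thesis using assms mixed_trace_Ints[OF assms] K unfolding OK_iff
    by (metis Ints_mult K_mult)
qed

lemma OK_minus: "x \<in> OK \<Longrightarrow> - x \<in> OK"
  using OK_mult[of "-1" x] Ints_OK[of "-1"] by simp

lemma OK_diff: "x \<in> OK \<Longrightarrow> y \<in> OK \<Longrightarrow> x - y \<in> OK"
  using OK_add[of x "- y"] OK_minus by simp

lemma OK_power: "x \<in> OK \<Longrightarrow> x ^ n \<in> OK"
  by (induction n) (auto simp: OK_mult Ints_OK)

lemma OK_sum: "(\<And>i. i \<in> A \<Longrightarrow> f i \<in> OK) \<Longrightarrow> sum f A \<in> OK"
  by (induction A rule: infinite_finite_induct) (auto simp: OK_add Ints_OK)

text \<open>The coordinates of an integer with respect to \<open>1/2\<close> and \<open>s / (2 d)\<close> are integers, as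
  \<open>x\<close> and \<open>x s\<close> have integral trace.\<close>

lemma OK_coords:
  assumes "x \<in> OK" shows "\<exists>t k. x = (of_int t * of_int d + of_int k * s) / (2 * of_int d)"
proof -
  obtain a b where *: "a \<in> \<rat>" "b \<in> \<rat>" "x = a + b * s"
    using assms OK_K by (meson K_E)
  have "x + galois x = 2 * a" using * by (simp add: galois_coords)
  then obtain t where t: "2 * a = of_int t" using assms by (metis OK_iff Ints_cases)
  have "x * s + galois x * galois s = 2 * b * of_int d"
    using * by (simp add: galois_coords algebra_simps)
  then obtain k where k: "2 * b * of_int d = of_int k" using mixed_trace_Ints[OF assms s_OK]
    by (metis Ints_cases)
  have "x = (of_int t * of_int d + of_int k * s) / (2 * of_int d)"
    using * d_pos unfolding t[symmetric] k[symmetric] by (simp add: field_simps)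
  thus ?thesis by blast
qed

text \<open>The integers of \<open>K\<close> that are rational are the ordinary ones, so it suffices to take for \<open>w\<close> an
  integer of \<open>K\<close> with the least positive coordinate at \<open>s / (2 d)\<close>.\<close>

lemma integral_basis: "\<exists>w\<in>OK. \<forall>x\<in>OK. \<exists>i j. x = of_int i + of_int j * w"
proof -
  define H where "H x k \<longleftrightarrow> x \<in> OK \<and> (\<exists>t. x = (of_int t * of_int d + of_int k * s) / (2 * of_int d))"
    for x :: real and k :: int
  have d0: "real_of_int d \<noteq> 0" using d_pos by simp
  \<comment> \<open>The coordinate of \<open>s\<close> is \<open>2 d > 0\<close>, so a positive one exists.\<close>
  have H_s: "H s (2 * d)"
  proof -
    have "s = (of_int 0 * of_int d + of_int (2 * d) * s) / (2 * of_int d)" using d0 by simp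
    thus ?thesis unfolding H_def using s_OK by blast
  qed
  have H_diff: "H (x - of_int j * y) (k - j * l)" if "H x k" "H y l" for x y k l j
  proof -
    obtain t u where *: "x = (of_int t * of_int d + of_int k * s) / (2 * of_int d)"
      "y = (of_int u * of_int d + of_int l * s) / (2 * of_int d)"
      using \<open>H x k\<close> \<open>H y l\<close> unfolding H_def by blast
    have "x - of_int j * y = (of_int (t - j * u) * of_int d + of_int (k - j * l) * s) / (2 * of_int d)"
      unfolding * using d0 by (simp add: field_simps)
    moreover have "x - of_int j * y \<in> OK"
      using OK_diff[OF _ OK_mult[OF Ints_OK[OF Ints_of_int]]] \<open>H x k\<close> \<open>H y l\<close>
      unfolding H_def by simp
    ultimately show ?thesis unfolding H_def by blast
  qed
  define n where "n = (LEAST n. n > 0 \<and> (\<exists>x. H x (int n)))"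
  have "nat (2 * d) > 0 \<and> (\<exists>x. H x (int (nat (2 * d))))"
    using d_pos H_s by auto
  hence "n > 0 \<and> (\<exists>x. H x (int n))" unfolding n_def by (rule LeastI)
  then obtain w where w: "n > 0" "H w (int n)" by blast
  have "\<exists>i j. x = of_int i + of_int j * w" if x: "x \<in> OK" for x
  proof -
    obtain k where k: "H x k" using OK_coords[OF x] x by (auto simp: H_def)
    define j where "j = k div int n"
    have *: "H (x - of_int j * w) (k mod int n)"
      using H_diff[OF k w(2), of j] by (simp add: j_def minus_div_mult_eq_mod)
    have "k mod int n = 0"
    proof (rule ccontr)
      assume "k mod int n \<noteq> 0"
      hence m: "k mod int n > 0" using w(1) pos_mod_sign[of "int n" k] by linarith
      hence "nat (k mod int n) > 0 \<and> (\<exists>x. H x (int (nat (k mod int n))))"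
        using * by auto
      hence "n \<le> nat (k mod int n)" unfolding n_def by (rule Least_le)
      moreover have "k mod int n < int n" using w(1) by simp
      ultimately show False using m by linarith
    qed
    hence "H (x - of_int j * w) 0" using * by simp
    hence "x - of_int j * w \<in> OK" "x - of_int j * w \<in> \<rat>" by (auto simp: H_def)
    then obtain i where "x - of_int j * w = of_int i" using OK_Rats by (metis Ints_cases)
    thus ?thesis by (metis diff_add_cancel)
  qed
  thus ?thesis using w(2) by (auto simp: H_def)
qed

section \<open>Prime ideals\<close>

text \<open>\<open>R\<close> is the ring of integers as a structure; its carrier is \<open>OK\<close> and its operations are those of
  the reals.\<close>

abbreviation "R \<equiv> integer_ring K"

lemma R_simps [simp]:
  "carrier R = OK" "x \<otimes>\<^bsub>R\<^esub> y = x * y" "x \<oplus>\<^bsub>R\<^esub> y = x + y" "\<one>\<^bsub>R\<^esub> = 1" "\<zero>\<^bsub>R\<^esub> = 0"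
  by (auto simp: integer_ring_def OK_def ring_of_type_algebra_def)

lemma R_cring: "cring R"
proof (rule cringI)
  show "abelian_group R"
    by (rule abelian_groupI) (auto simp: OK_add Ints_OK intro: bexI[OF _ OK_minus])
  show "comm_monoid R"
    by (rule comm_monoidI) (auto simp: OK_mult Ints_OK)
qed (auto simp: algebra_simps)

lemma ideal_facts:
  assumes "ideal I R"
  shows "I \<subseteq> OK" "0 \<in> I" "x \<in> I \<Longrightarrow> y \<in> I \<Longrightarrow> x + y \<in> I"
    "x \<in> I \<Longrightarrow> y \<in> OK \<Longrightarrow> y * x \<in> I" "x \<in> I \<Longrightarrow> y \<in> OK \<Longrightarrow> x * y \<in> I"
    "x \<in> I \<Longrightarrow> y \<in> I \<Longrightarrow> x - y \<in> I"
proof -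
  interpret ideal I R by fact
  show "I \<subseteq> OK" using a_subset by simp
  show "0 \<in> I" using additive_subgroup.zero_closed[OF is_additive_subgroup] by simp
  show add: "x + y \<in> I" if "x \<in> I" "y \<in> I" for x y
    using additive_subgroup.a_closed[OF is_additive_subgroup that] by simp
  show m: "y * x \<in> I" if "x \<in> I" "y \<in> OK" for x y using I_l_closed[of x y] that by simp
  show "x * y \<in> I" if "x \<in> I" "y \<in> OK" using m[OF that] by (simp add: mult.commute)
  show "x - y \<in> I" if "x \<in> I" "y \<in> I"
    using add[OF that(1) m[OF that(2) Ints_OK[of "-1"]]] by simp
qed

lemma place_ideal: "\<pp> \<in> finite_places K \<Longrightarrow> ideal \<pp> R"
  by (auto simp: finite_places_def primeideal_def)

lemmas place_facts = ideal_facts[OF place_ideal]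

lemma place_one: assumes "\<pp> \<in> finite_places K" shows "1 \<notin> \<pp>"
proof
  assume "1 \<in> \<pp>"
  hence "OK \<subseteq> \<pp>" using place_facts(4)[OF assms, of 1] by auto
  moreover have "carrier R \<noteq> \<pp>" using assms unfolding finite_places_def
    by (auto dest: primeideal.I_notcarr)
  ultimately show False using place_facts(1)[OF assms] by auto
qed

lemma place_prime:
  "\<pp> \<in> finite_places K \<Longrightarrow> x \<in> OK \<Longrightarrow> y \<in> OK \<Longrightarrow> x * y \<in> \<pp> \<Longrightarrow> x \<in> \<pp> \<or> y \<in> \<pp>"
  using primeideal.I_prime[of \<pp> R x y] unfolding finite_places_def by auto

lemma place_contains_prime_factor:
  assumes "\<pp> \<in> finite_places K" "real n \<in> \<pp>" "n > 0"
  shows "\<exists>l. prime l \<and> l dvd n \<and> real l \<in> \<pp>"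
  using assms(2,3)
proof (induction n rule: less_induct)
  case (less n)
  have "n \<noteq> 1" using less.prems place_one[OF assms(1)] by auto
  then obtain l where l: "prime l" "l dvd n" using prime_factor_nat by blast
  then obtain k where k: "n = l * k" by auto
  have "real l * real k \<in> \<pp>" using less.prems k by simp
  hence "real l \<in> \<pp> \<or> real k \<in> \<pp>"
    using place_prime[OF assms(1)] Ints_OK by simp
  thus ?case
  proof
    assume "real l \<in> \<pp>" thus ?thesis using l by blast
  next
    assume a: "real k \<in> \<pp>"
    have "k < n" "k > 0" using k l less.prems prime_gt_1_nat[OF l(1)] by auto
    from less.IH[OF this(1) a this(2)] show ?thesis using k by auto
  qed
qed

text \<open>The norm of an element of a prime ideal lies in the ideal, being a multiple of that
  element.\<close>

lemma place_contains_norm_prime: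
  assumes "\<pp> \<in> finite_places K" "x \<in> \<pp>" "x * galois x = of_int m" "m \<noteq> 0"
  shows "\<exists>l. prime l \<and> int l dvd m \<and> real l \<in> \<pp>"
proof -
  have "x \<in> OK" using assms place_facts(1) by blast
  hence "of_int m \<in> \<pp>" using place_facts(5)[OF assms(1,2) galois_OK] assms(3) by metis
  moreover have "- real_of_int m \<in> \<pp>" if "real_of_int m \<in> \<pp>"
    using place_facts(4)[OF assms(1) that Ints_OK[of "-1"]] by simp
  ultimately have "real (nat \<bar>m\<bar>) \<in> \<pp>" by (cases "m \<ge> 0") auto
  from place_contains_prime_factor[OF assms(1) this] assms(4)
  obtain l where "prime l" "l dvd nat \<bar>m\<bar>" "real l \<in> \<pp>" by auto
  thus ?thesis by auto
qed

lemma place_over_prime: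
  assumes "\<pp> \<in> finite_places K" shows "\<exists>l. prime l \<and> real l \<in> \<pp>"
proof -
  have "\<pp> \<noteq> {0}" using assms by (simp add: finite_places_def)
  then obtain x where x: "x \<in> \<pp>" "x \<noteq> 0" using place_facts(2)[OF assms] by blast
  have "x \<in> OK" using place_facts(1)[OF assms] x by blast
  then obtain m where m: "x * galois x = of_int m" by (metis OK_iff Ints_cases)
  have "m \<noteq> 0" using m x \<open>x \<in> OK\<close> OK_K galois_eq_0_iff by fastforce
  thus ?thesis using place_contains_norm_prime[OF assms x(1) m] by blast
qed

lemma place_int_iff:
  assumes "\<pp> \<in> finite_places K" "prime l" "real l \<in> \<pp>"
  shows "of_int m \<in> \<pp> \<longleftrightarrow> int l dvd m"
proof
  assume "int l dvd m"
  then obtain k where "m = int l * k" by auto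
  thus "of_int m \<in> \<pp>" using place_facts(5)[OF assms(1,3) Ints_OK[of "of_int k"]] by simp
next
  assume a: "of_int m \<in> \<pp>"
  show "int l dvd m"
  proof (rule ccontr)
    assume "\<not> int l dvd m"
    hence "Rings.coprime (int l) m" using assms(2) by (simp add: prime_imp_coprime)
    then obtain u v where uv: "u * int l + v * m = 1" by (metis bezout_int coprime_imp_gcd_eq_1)
    have "of_int u * real l + of_int v * of_int m \<in> \<pp>"
      using place_facts(3,4)[OF assms(1)] a assms(3) Ints_OK by simp
    also have "of_int u * real l + of_int v * of_int m = real_of_int (u * int l + v * m)" by simp
    finally show False using uv place_one[OF assms(1)] by simp
  qed
qed

lemma place_inverse_int:
  assumes "\<pp> \<in> finite_places K" "of_int m \<notin> \<pp>"
  shows "\<exists>u\<in>OK. u * of_int m - 1 \<in> \<pp>"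
proof -
  obtain l where l: "prime l" "real l \<in> \<pp>" using place_over_prime[OF assms(1)] by blast
  have "Rings.coprime (int l) m" using l assms place_int_iff[OF assms(1) l] by (simp add: prime_imp_coprime)
  then obtain u v where uv: "u * int l + v * m = 1" by (metis bezout_int coprime_imp_gcd_eq_1)
  hence "v * m - 1 = int l * (- u)" by (simp add: algebra_simps)
  hence "of_int (v * m - 1) \<in> \<pp>" using place_int_iff[OF assms(1) l] dvd_triv_left by metis
  thus ?thesis by (intro bexI[of _ "of_int v"]) (auto simp: Ints_OK)
qed

text \<open>Prime ideals are maximal: modulo \<open>\<pp>\<close>, an inverse of \<open>x\<close> comes from its norm, or from its
  trace when the conjugate of \<open>x\<close> lies in \<open>\<pp>\<close>.\<close>

lemma place_inverse:
  assumes "\<pp> \<in> finite_places K" "x \<in> OK" "x \<notin> \<pp>"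
  shows "\<exists>u\<in>OK. u * x - 1 \<in> \<pp>"
proof (cases "galois x \<in> \<pp>")
  case False
  obtain m where m: "x * galois x = of_int m" using assms(2) by (metis OK_iff Ints_cases)
  have "of_int m \<notin> \<pp>" using False place_prime[OF assms(1,2) galois_OK[OF assms(2)]] assms(3) m by metis
  then obtain u where "u \<in> OK" "u * of_int m - 1 \<in> \<pp>" using place_inverse_int[OF assms(1)] by blast
  thus ?thesis using m galois_OK[OF assms(2)]
    by (intro bexI[of _ "u * galois x"]) (auto simp: OK_mult ac_simps)
next
  case True
  obtain t where t: "x + galois x = of_int t" using assms(2) by (metis OK_iff Ints_cases)
  have "of_int t \<notin> \<pp>"
    using place_facts(6)[OF assms(1) _ True, of "of_int t"] t assms(3) by (metis add_diff_cancel_right')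
  then obtain u where u: "u \<in> OK" "u * of_int t - 1 \<in> \<pp>" using place_inverse_int[OF assms(1)] by blast
  have "(u * of_int t - 1) - u * galois x \<in> \<pp>"
    by (rule place_facts(6)[OF assms(1) u(2) place_facts(4)[OF assms(1) True u(1)]])
  also have "(u * of_int t - 1) - u * galois x = u * x - 1"
    unfolding t[symmetric] by (simp add: algebra_simps)
  finally show ?thesis using u(1) by blast
qed

section \<open>Norms of the primes above a rational prime\<close>

text \<open>The nonzero prime ideals above the rational prime \<open>l\<close>.\<close>

definition places_over :: "nat \<Rightarrow> real set set" where
  "places_over l = {\<pp> \<in> finite_places K. real l \<in> \<pp>}"

text \<open>The residue class of \<open>x\<close> modulo \<open>\<pp>\<close>.\<close>

abbreviation coset :: "real set \<Rightarrow> real \<Rightarrow> real set" where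
  "coset \<pp> x \<equiv> \<pp> +>\<^bsub>R\<^esub> x"

lemma coset_def': "coset \<pp> x = (\<lambda>h. h + x) ` \<pp>"
  by (auto simp: a_r_coset_def')

lemma coset_eq_iff:
  assumes "\<pp> \<in> finite_places K"
  shows "coset \<pp> x = coset \<pp> y \<longleftrightarrow> x - y \<in> \<pp>"
proof
  assume "coset \<pp> x = coset \<pp> y"
  moreover have "x \<in> coset \<pp> x" unfolding coset_def' using place_facts(2)[OF assms] by force
  ultimately obtain h where "h \<in> \<pp>" "x = h + y" unfolding coset_def' by auto
  thus "x - y \<in> \<pp>" by simp
next
  have *: "coset \<pp> x \<subseteq> coset \<pp> y" if "x - y \<in> \<pp>" for x y
  proof
    fix z assume "z \<in> coset \<pp> x"
    then obtain h where h: "h \<in> \<pp>" "z = h + x" unfolding coset_def' by auto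
    hence "z = (h + (x - y)) + y" by simp
    thus "z \<in> coset \<pp> y" unfolding coset_def' using place_facts(3)[OF assms h(1) that] by blast
  qed
  assume a: "x - y \<in> \<pp>"
  hence "y - x \<in> \<pp>" using place_facts(6)[OF assms place_facts(2)[OF assms] a] by simp
  thus "coset \<pp> x = coset \<pp> y" using *[OF a] * by blast
qed

lemma ideal_norm_eq: "ideal_norm K \<pp> = card (coset \<pp> ` OK)"
proof -
  have "carrier (R Quot \<pp>) = coset \<pp> ` OK"
    by (auto simp: FactRing_def A_RCOSETS_def')
  thus ?thesis by (simp add: ideal_norm_def)
qed

text \<open>The Chinese remainder theorem, as the existence of an element that is \<open>1\<close> modulo one prime and
  \<open>0\<close> modulo finitely many others.\<close>

lemma place_separate:
  assumes "\<pp> \<in> finite_places K" "finite S" "S \<subseteq> finite_places K" "\<pp> \<notin> S"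
  shows "\<exists>e\<in>OK. e - 1 \<in> \<pp> \<and> (\<forall>\<qq>\<in>S. e \<in> \<qq>)"
  using assms(2-)
proof (induction S)
  case empty
  thus ?case using place_facts(2)[OF assms(1)] Ints_OK[OF Ints_1] by (intro bexI[of _ 1]) simp_all
next
  case (insert \<qq> S)
  then obtain e where e: "e \<in> OK" "e - 1 \<in> \<pp>" "\<forall>\<qq>\<in>S. e \<in> \<qq>" by auto
  have q: "\<qq> \<in> finite_places K" "\<qq> \<noteq> \<pp>" using insert by auto
  \<comment> \<open>Maximality of \<open>\<qq>\<close> excludes that \<open>\<qq>\<close> is a proper subset of \<open>\<pp>\<close>.\<close>
  have "\<exists>f\<in>\<qq>. f \<notin> \<pp>"
  proof (rule ccontr)
    assume "\<not> ?thesis"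
    hence sub: "\<qq> \<subseteq> \<pp>" by blast
    then obtain x where x: "x \<in> \<pp>" "x \<notin> \<qq>" using q by blast
    have xO: "x \<in> OK" using x place_facts(1)[OF assms(1)] by blast
    then obtain u where u: "u \<in> OK" "u * x - 1 \<in> \<qq>" using place_inverse[OF q(1)] x by blast
    have "u * x - (u * x - 1) \<in> \<pp>"
      using place_facts(6)[OF assms(1)] place_facts(4)[OF assms(1) x(1) u(1)] u(2) sub by blast
    thus False using place_one[OF assms(1)] by simp
  qed
  then obtain f where f: "f \<in> \<qq>" "f \<notin> \<pp>" by blast
  have fO: "f \<in> OK" using f place_facts(1)[OF q(1)] by blast
  obtain u where u: "u \<in> OK" "u * f - 1 \<in> \<pp>" using place_inverse[OF assms(1) fO f(2)] by blast
  have "e * (u * f) - 1 = (e - 1) * (u * f) + (u * f - 1)" by (simp add: algebra_simps)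
  hence 1: "e * (u * f) - 1 \<in> \<pp>"
    using place_facts(3,5)[OF assms(1)] e(2) u OK_mult[OF u(1) fO] by metis
  have 2: "e * (u * f) \<in> \<qq>" using place_facts(4)[OF q(1)] f(1) u(1) e(1) by blast
  have 3: "e * (u * f) \<in> \<rr>" if "\<rr> \<in> S" for \<rr>
    using place_facts(5)[of \<rr>] that insert.prems e(3) OK_mult[OF u(1) fO] by auto
  show ?case
    by (rule bexI[of _ "e * (u * f)"]) (use 1 2 3 OK_mult e(1) u(1) fO in auto)
qed

text \<open>By the Chinese remainder theorem every family of residue classes modulo the ideals in \<open>S\<close> comes
  from one integer of \<open>K\<close>, and, as the ideals contain \<open>l\<close>, from one of the \<open>l\<^sup>2\<close> integers
  \<open>i + j w\<close> with \<open>0 \<le> i, j < l\<close>.\<close>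

lemma prod_ideal_norm_le:
  assumes l: "prime l" and S: "finite S" "S \<subseteq> places_over l"
  shows "(\<Prod>\<pp>\<in>S. ideal_norm K \<pp>) \<le> l\<^sup>2" "\<And>\<pp>. \<pp> \<in> S \<Longrightarrow> finite (coset \<pp> ` OK)"
proof -
  obtain w where w: "w \<in> OK" "\<And>x. x \<in> OK \<Longrightarrow> \<exists>i j. x = of_int i + of_int j * w"
    using integral_basis by blast
  have l0: "l > 0" using l by (simp add: prime_gt_0_nat)
  have SP: "\<pp> \<in> finite_places K" "real l \<in> \<pp>" if "\<pp> \<in> S" for \<pp>
    using S that by (auto simp: places_over_def)
  define B where "B = {0..<int l} \<times> {0..<int l}"
  define g where "g = (\<lambda>(i, j). real_of_int i + of_int j * w)"
  define F where "F = (\<lambda>b. \<lambda>\<pp>\<in>S. coset \<pp> (g b))"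
  have red: "\<exists>b\<in>B. \<forall>\<pp>\<in>S. x - g b \<in> \<pp>" if x: "x \<in> OK" for x
  proof -
    obtain i j where ij: "x = of_int i + of_int j * w" using w(2)[OF x] by blast
    have "x - g (i mod int l, j mod int l) = of_int (i - i mod int l) + of_int (j - j mod int l) * w"
      unfolding ij g_def by (simp add: algebra_simps)
    also have "\<dots> = real l * (of_int (i div int l) + of_int (j div int l) * w)"
      unfolding minus_mod_eq_mult_div by (simp add: algebra_simps)
    finally have eq: "x - g (i mod int l, j mod int l) = real l * (of_int (i div int l) + of_int (j div int l) * w)" .
    have O: "of_int (i div int l) + of_int (j div int l) * w \<in> OK"
      using w(1) by (auto intro!: OK_add OK_mult simp: Ints_OK)
    show ?thesis
    proof (rule bexI)
      show "\<forall>\<pp>\<in>S. x - g (i mod int l, j mod int l) \<in> \<pp>"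
        unfolding eq using place_facts(5)[OF SP(1) SP(2) O] by blast
      show "(i mod int l, j mod int l) \<in> B" using l0 by (simp add: B_def)
    qed
  qed
  have finB: "finite B" and cardB: "card B = l\<^sup>2"
    by (simp_all add: B_def power2_eq_square)
  show "finite (coset \<pp> ` OK)" if p: "\<pp> \<in> S" for \<pp>
  proof (rule finite_subset)
    show "coset \<pp> ` OK \<subseteq> (\<lambda>b. coset \<pp> (g b)) ` B"
    proof (rule image_subsetI)
      fix x assume "x \<in> OK"
      then obtain b where b: "b \<in> B" "x - g b \<in> \<pp>" using red p by meson
      hence "coset \<pp> x = coset \<pp> (g b)" using coset_eq_iff[OF SP(1)[OF p]] by simp
      thus "coset \<pp> x \<in> (\<lambda>b. coset \<pp> (g b)) ` B" using b(1) by (rule image_eqI)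
    qed
  qed (use finB in auto)
  have "PiE S (\<lambda>\<pp>. coset \<pp> ` OK) \<subseteq> F ` B"
  proof
    fix h assume h: "h \<in> PiE S (\<lambda>\<pp>. coset \<pp> ` OK)"
    hence "\<forall>\<pp>\<in>S. \<exists>x\<in>OK. h \<pp> = coset \<pp> x" by (meson PiE_mem imageE)
    then obtain r where r: "\<And>\<pp>. \<pp> \<in> S \<Longrightarrow> r \<pp> \<in> OK \<and> h \<pp> = coset \<pp> (r \<pp>)" by metis
    have "\<forall>\<pp>\<in>S. \<exists>e\<in>OK. e - 1 \<in> \<pp> \<and> (\<forall>\<qq>\<in>S - {\<pp>}. e \<in> \<qq>)"
    proof
      fix \<pp> assume p: "\<pp> \<in> S"
      show "\<exists>e\<in>OK. e - 1 \<in> \<pp> \<and> (\<forall>\<qq>\<in>S - {\<pp>}. e \<in> \<qq>)"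
        by (rule place_separate[OF SP(1)[OF p]]) (use S(1) SP(1) in auto)
    qed
    then obtain e where e: "\<And>\<pp>. \<pp> \<in> S \<Longrightarrow> e \<pp> \<in> OK \<and> e \<pp> - 1 \<in> \<pp> \<and> (\<forall>\<qq>\<in>S - {\<pp>}. e \<pp> \<in> \<qq>)"
      by metis
    define y where "y = (\<Sum>\<pp>\<in>S. e \<pp> * r \<pp>)"
    have "y \<in> OK" unfolding y_def using e r by (intro OK_sum OK_mult) auto
    then obtain b where b: "b \<in> B" "\<forall>\<pp>\<in>S. y - g b \<in> \<pp>" using red by blast
    have yr: "y - r \<pp> \<in> \<pp>" if p: "\<pp> \<in> S" for \<pp>
    proof -
      have pl: "\<pp> \<in> finite_places K" using SP(1)[OF p] .
      have "(\<Sum>\<qq>\<in>T. e \<qq> * r \<qq>) \<in> \<pp>" if "T \<subseteq> S - {\<pp>}" for T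
        using that
      proof (induction T rule: infinite_finite_induct)
        case (insert \<qq> T)
        have "e \<qq> * r \<qq> \<in> \<pp>" using place_facts(5)[OF pl] e r insert.prems p by auto
        thus ?case using insert place_facts(3)[OF pl] by auto
      qed (use place_facts(2)[OF pl] in auto)
      hence rest: "(\<Sum>\<qq>\<in>S - {\<pp>}. e \<qq> * r \<qq>) \<in> \<pp>" by blast
      have "y = e \<pp> * r \<pp> + (\<Sum>\<qq>\<in>S - {\<pp>}. e \<qq> * r \<qq>)"
        unfolding y_def using p S(1) by (simp add: sum.remove)
      hence "y - r \<pp> = (e \<pp> - 1) * r \<pp> + (\<Sum>\<qq>\<in>S - {\<pp>}. e \<qq> * r \<qq>)" by (simp add: algebra_simps)
      thus ?thesis using place_facts(3)[OF pl place_facts(5)[OF pl] rest] e[OF p] r[OF p] by metis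
    qed
    have "h = F b"
    proof
      fix \<pp>
      show "h \<pp> = F b \<pp>"
      proof (cases "\<pp> \<in> S")
        case True
        have pl: "\<pp> \<in> finite_places K" using SP(1)[OF True] .
        have "(y - g b) - (y - r \<pp>) \<in> \<pp>"
          using place_facts(6)[OF pl] b(2) yr[OF True] True by blast
        hence "coset \<pp> (r \<pp>) = coset \<pp> (g b)"
          using coset_eq_iff[OF pl] by simp
        thus ?thesis using r[OF True] True by (simp add: F_def)
      next
        case False
        thus ?thesis using h by (auto simp: F_def PiE_def extensional_def)
      qed
    qed
    thus "h \<in> F ` B" using b by blast
  qed
  hence "card (PiE S (\<lambda>\<pp>. coset \<pp> ` OK)) \<le> card B"
    using finB by (meson card_image_le card_mono finite_imageI order_trans)
  thus "(\<Prod>\<pp>\<in>S. ideal_norm K \<pp>) \<le> l\<^sup>2"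
    using S(1) cardB by (simp add: card_PiE ideal_norm_eq)
qed

lemma ideal_norm_ge_2:
  assumes "prime l" "\<pp> \<in> places_over l" shows "ideal_norm K \<pp> \<ge> 2"
proof -
  have pl: "\<pp> \<in> finite_places K" using assms by (simp add: places_over_def)
  have fin: "finite (coset \<pp> ` OK)" using prod_ideal_norm_le(2)[OF assms(1), of "{\<pp>}"] assms by simp
  have "coset \<pp> 0 \<noteq> coset \<pp> 1" using coset_eq_iff[OF pl] place_one[OF pl]
      place_facts(4)[OF pl, of "-1" "-1"] Ints_OK[of "-1"] by auto
  hence "2 = card {coset \<pp> 0, coset \<pp> 1}" by simp
  also have "\<dots> \<le> card (coset \<pp> ` OK)" using fin by (intro card_mono) (auto simp: Ints_OK)
  finally show ?thesis by (simp add: ideal_norm_eq)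
qed

text \<open>Each prime ideal above \<open>l\<close> contributes a factor of at least \<open>2\<close> to a product bounded by
  \<open>l\<^sup>2\<close>.\<close>

lemma finite_places_over: assumes "prime l" shows "finite (places_over l)"
proof (rule ccontr)
  assume "infinite (places_over l)"
  then obtain S where S: "S \<subseteq> places_over l" "finite S" "card S = l\<^sup>2"
    by (meson infinite_arbitrarily_large)
  have "2 ^ card S = (\<Prod>\<pp>\<in>S. 2::nat)" by simp
  also have "\<dots> \<le> (\<Prod>\<pp>\<in>S. ideal_norm K \<pp>)"
    using S ideal_norm_ge_2[OF assms] by (intro prod_mono) auto
  also have "\<dots> \<le> card S" using prod_ideal_norm_le(1)[OF assms S(2,1)] S by simp
  finally show False using less_exp[of "card S"] by simp
qed

lemma sum_ln_norm_places_over: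
  assumes "prime l"
  shows "(\<Sum>\<pp>\<in>places_over l. ln (real (ideal_norm K \<pp>))) \<le> 2 * ln (real l)"
proof -
  have pos: "real (ideal_norm K \<pp>) > 0" if "\<pp> \<in> places_over l" for \<pp>
    using ideal_norm_ge_2[OF assms that] by simp
  have "(\<Sum>\<pp>\<in>places_over l. ln (real (ideal_norm K \<pp>))) = ln (\<Prod>\<pp>\<in>places_over l. real (ideal_norm K \<pp>))"
    using pos by (intro ln_prod[symmetric] finite_places_over[OF assms]) fastforce
  also have "\<dots> \<le> ln ((real l)\<^sup>2)"
  proof (rule ln_mono)
    show "0 < (\<Prod>\<pp>\<in>places_over l. real (ideal_norm K \<pp>))"
      by (rule prod_pos) (rule pos)
    have "real (\<Prod>\<pp>\<in>places_over l. ideal_norm K \<pp>) \<le> real (l\<^sup>2)"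
      using prod_ideal_norm_le(1)[OF assms finite_places_over[OF assms] order_refl]
      by (rule of_nat_mono)
    thus "(\<Prod>\<pp>\<in>places_over l. real (ideal_norm K \<pp>)) \<le> (real l)\<^sup>2" by simp
  qed
  also have "\<dots> = 2 * ln (real l)" using prime_gt_0_nat[OF assms] by (simp add: ln_realpow)
  finally show ?thesis .
qed

section \<open>Valuations of units and of elements outside a prime\<close>

text \<open>The \<open>n\<close>-th power of an ideal.\<close>

abbreviation ipow :: "real set \<Rightarrow> nat \<Rightarrow> real set" where
  "ipow \<pp> n \<equiv> \<pp> [^]\<^bsub>ideals_set R\<^esub> n"

lemma ipow_0: "ipow \<pp> 0 = OK"
  by (simp add: nat_pow_def ideals_set_def)

lemma ipow_Suc: "ipow \<pp> (Suc n) = ideal_prod R (ipow \<pp> n) \<pp>"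
  by (simp add: nat_pow_def ideals_set_def)

lemma ipow_ideal: assumes "ideal I R" shows "ideal (ipow I n) R"
proof (induction n)
  case 0
  show ?case using ring.oneideal[OF cring.axioms(1)[OF R_cring]] unfolding ipow_0 by simp
next
  case (Suc n)
  show ?case unfolding ipow_Suc
    by (rule ring.ideal_prod_is_ideal[OF cring.axioms(1)[OF R_cring] Suc assms])
qed

lemma power_in_ipow: assumes "x \<in> I" "ideal I R" shows "x ^ n \<in> ipow I n"
proof (induction n)
  case 0 thus ?case unfolding ipow_0 by (simp add: Ints_OK)
next
  case (Suc n)
  have "x ^ n \<otimes>\<^bsub>R\<^esub> x \<in> ideal_prod R (ipow I n) I"
    by (rule ideal_prod.prod[OF Suc assms(1)])
  thus ?case unfolding ipow_Suc by (simp add: mult.commute)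
qed

text \<open>Multiplication by an element \<open>c\<close> outside \<open>\<pp>\<close> does not change membership in the powers of
  \<open>\<pp>\<close>: if \<open>1 - u c\<close> lies in \<open>\<pp>\<close>, then \<open>(1 - u c)\<^sup>n\<close> lies in the \<open>n\<close>-th power and is congruent to
  \<open>1\<close> modulo \<open>c\<close>.\<close>

lemma ipow_mult_iff:
  assumes "\<pp> \<in> finite_places K" "c \<in> OK" "c \<notin> \<pp>" "b \<in> OK"
  shows "c * b \<in> ipow \<pp> n \<longleftrightarrow> b \<in> ipow \<pp> n"
proof
  have I: "ideal (ipow \<pp> n) R" using ipow_ideal[OF place_ideal[OF assms(1)]] .
  show "c * b \<in> ipow \<pp> n" if "b \<in> ipow \<pp> n" using ideal_facts(4)[OF I that assms(2)] .
  assume cb: "c * b \<in> ipow \<pp> n"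
  obtain u where u: "u \<in> OK" "u * c - 1 \<in> \<pp>" using place_inverse[OF assms(1-3)] by blast
  define q where "q = u * c - 1"
  have qn: "q ^ n \<in> ipow \<pp> n" unfolding q_def by (rule power_in_ipow[OF u(2) place_ideal[OF assms(1)]])
  have "\<exists>w\<in>OK. (- q) ^ n = 1 + c * w" for n
  proof (induction n)
    case 0 show ?case by (rule bexI[of _ 0]) (auto simp: Ints_OK)
  next
    case (Suc n)
    then obtain w where w: "w \<in> OK" "(- q) ^ n = 1 + c * w" by blast
    have "(- q) ^ Suc n = 1 + c * (w - u - u * c * w)"
      unfolding power_Suc w(2) by (simp add: q_def algebra_simps)
    thus ?case using w(1) u(1) assms(2) by (intro bexI[of _ "w - u - u * c * w"]) (auto intro!: OK_diff OK_mult)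
  qed
  then obtain w where w: "w \<in> OK" "(- q) ^ n = 1 + c * w" by blast
  have mq: "(- q) ^ n \<in> ipow \<pp> n"
    using ideal_facts(4)[OF I qn OK_power[OF Ints_OK[of "-1"]], of n] by (simp flip: power_mult_distrib)
  have "b = (- q) ^ n * b - (c * b) * w" by (simp add: w(2) algebra_simps)
  moreover have "(- q) ^ n * b - (c * b) * w \<in> ipow \<pp> n"
    by (intro ideal_facts(6)[OF I] ideal_facts(5)[OF I mq assms(4)] ideal_facts(5)[OF I cb w(1)])
  ultimately show "b \<in> ipow \<pp> n" by simp
qed

lemma int_valuation_mult_outside:
  assumes "\<pp> \<in> finite_places K" "c \<in> OK" "c \<notin> \<pp>" "b \<in> OK"
  shows "int_valuation K \<pp> (c * b) = int_valuation K \<pp> b"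
  unfolding int_valuation_def using ipow_mult_iff[OF assms] by simp

text \<open>Well-definedness of the valuation in this case is part of the proof: \<open>c = a / b\<close> means
  \<open>a = c b\<close>, and \<open>a\<close>, \<open>b\<close> then lie in the same powers of \<open>\<pp>\<close>.\<close>

lemma valuation_outside:
  assumes "\<pp> \<in> finite_places K" "c \<in> OK" "c \<notin> \<pp>"
  shows "valuation K \<pp> c = 0"
  unfolding valuation_def
proof (rule the_equality)
  have c0: "c \<noteq> 0" using assms place_facts(2)[OF assms(1)] by blast
  have "int_valuation K \<pp> c = int_valuation K \<pp> 1"
    using int_valuation_mult_outside[OF assms, of 1] by (simp add: Ints_OK)
  thus "\<exists>a b. a \<in> carrier R - {0} \<and> b \<in> carrier R - {0} \<and> c = a / b \<and>
      0 = int (int_valuation K \<pp> a) - int (int_valuation K \<pp> b)"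
    using c0 assms by (intro exI[of _ c] exI[of _ 1]) (auto simp: Ints_OK)
next
  fix k assume "\<exists>a b. a \<in> carrier R - {0} \<and> b \<in> carrier R - {0} \<and> c = a / b \<and>
      k = int (int_valuation K \<pp> a) - int (int_valuation K \<pp> b)"
  then obtain a b where ab: "b \<in> OK" "b \<noteq> 0" "c = a / b"
      "k = int (int_valuation K \<pp> a) - int (int_valuation K \<pp> b)" by auto
  hence "a = c * b" by simp
  thus "k = 0" using int_valuation_mult_outside[OF assms ab(1)] ab(4) by simp
qed

lemma unit_not_in_place:
  assumes "\<pp> \<in> finite_places K" "x \<in> OK" "y \<in> OK" "x * y = 1"
  shows "x \<notin> \<pp>"
  using place_facts(5)[OF assms(1) _ assms(3)] assms(4) place_one[OF assms(1)] by metis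

section \<open>Degree and real embeddings\<close>

lemma field_degree_K: "field_degree K = 2"
proof -
  let ?T = "ring_of_type_algebra :: real ring"
  interpret T: field ?T by (rule field_from_type_algebra)
  have T [simp]: "carrier ?T = UNIV" "x \<otimes>\<^bsub>?T\<^esub> y = x * y" "x \<oplus>\<^bsub>?T\<^esub> y = x + y" "\<one>\<^bsub>?T\<^esub> = 1" "\<zero>\<^bsub>?T\<^esub> = 0" for x y
    by (auto simp: ring_of_type_algebra_def)
  have m [simp]: "\<ominus>\<^bsub>?T\<^esub> x = - x" for x using T.minus_equality[of "-x" x] by simp
  have sub: "subfield \<rat> ?T"
  proof (rule T.subfieldI')
    show "subring \<rat> ?T" by (rule T.subringI) auto
    fix k :: real assume k: "k \<in> \<rat> - {\<zero>\<^bsub>?T\<^esub>}"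
    have "inv\<^bsub>?T\<^esub> k = 1 / k" by (rule T.comm_inv_char) (use k in auto)
    thus "inv\<^bsub>?T\<^esub> k \<in> \<rat>" using k by auto
  qed
  have le: "T.line_extension \<rat> u E = {k * u + e | k e. k \<in> \<rat> \<and> e \<in> E}" for u E
    unfolding T.line_extension_def set_add_def' r_coset_def by (auto simp: set_add_def set_mult_def)
  have s1: "T.Span \<rat> [1] = \<rat>" unfolding T.Span.simps by (auto simp: le)
  have s2: "T.Span \<rat> [s, 1] = K"
  proof -
    have "T.Span \<rat> [s, 1] = T.line_extension \<rat> s \<rat>" using s1 by simp
    also have "\<dots> = K"
      unfolding le set_eq_iff mem_Collect_eq K_iff by (metis add.commute)
    finally show ?thesis .
  qed
  have "T.independent \<rat> [s, 1]"
  proof (intro T.li_Cons T.li_Nil)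
    show "s \<notin> T.Span \<rat> [1]" using s1 s_irrational by simp
  qed auto
  hence "T.dimension 2 \<rat> K" using T.dimension_independent[of \<rat> "[s, 1]"] s2 by (simp add: numeral_2_eq_2)
  from T.dimI[OF sub this] show ?thesis by (simp add: field_degree_def over_def)
qed

text \<open>An embedding fixes the rationals and sends \<open>s\<close> to one of the two square roots of \<open>d\<close>.\<close>

lemma real_embeddings_K: "real_embeddings K = {restrict (\<lambda>x. x) K, restrict galois K}"
proof -
  have hom: "\<sigma> \<in> ring_hom (field_ring K) (ring_of_type_algebra :: real ring) \<longleftrightarrow>
     (\<forall>x\<in>K. \<forall>y\<in>K. \<sigma> (x * y) = \<sigma> x * \<sigma> y \<and> \<sigma> (x + y) = \<sigma> x + \<sigma> y) \<and> \<sigma> 1 = 1" for \<sigma>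
    by (auto simp: ring_hom_def field_ring_def ring_of_type_algebra_def)
  have 1: "1 \<in> K" by (rule Rats_K) simp
  show ?thesis
  proof (intro equalityI subsetI)
    fix \<sigma> assume "\<sigma> \<in> real_embeddings K"
    hence \<sigma>: "\<And>x y. x \<in> K \<Longrightarrow> y \<in> K \<Longrightarrow> \<sigma> (x * y) = \<sigma> x * \<sigma> y"
       "\<And>x y. x \<in> K \<Longrightarrow> y \<in> K \<Longrightarrow> \<sigma> (x + y) = \<sigma> x + \<sigma> y" "\<sigma> 1 = 1"
       and ext: "\<sigma> \<in> extensional K"
      by (auto simp: real_embeddings_def hom)
    have 0: "\<sigma> 0 = 0" using \<sigma>(2)[of 0 0] Rats_K[of 0] by simp
    have nat: "\<sigma> (of_nat n) = of_nat n" for n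
    proof (induction n)
      case (Suc n) thus ?case using \<sigma>(2)[OF 1 Rats_K[of "of_nat n"]] \<sigma>(3) by simp
    qed (use 0 in simp)
    have neg: "\<sigma> (- x) = - \<sigma> x" if "x \<in> K" for x
      using \<sigma>(2)[OF that K_minus(1)[OF that]] 0 by simp
    have int: "\<sigma> (of_int m) = of_int m" for m
    proof (cases "m \<ge> 0")
      case True thus ?thesis using nat[of "nat m"] by simp
    next
      case False thus ?thesis using nat[of "nat (- m)"] neg[OF Rats_K[of "of_nat (nat (- m))"]] by simp
    qed
    have rat: "\<sigma> a = a" if a: "a \<in> \<rat>" for a
    proof -
      obtain m n where mn: "n > 0" "a = of_int m / of_int n" using a by (metis Rats_cases')
      have "\<sigma> (a * of_int n) = \<sigma> a * of_int n"
        using \<sigma>(1)[OF Rats_K[OF a] Rats_K[of "of_int n"]] int by simp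
      moreover have "a * of_int n = of_int m" using mn by simp
      ultimately have "\<sigma> a * of_int n = a * of_int n" using int[of m] by metis
      moreover have "real_of_int n \<noteq> 0" using mn(1) by simp
      ultimately show ?thesis using mult_right_cancel by blast
    qed
    have "\<sigma> s * \<sigma> s = s * s" using \<sigma>(1)[OF s_K s_K] int[of d] by simp
    hence ss: "\<sigma> s = s \<or> \<sigma> s = - s" using square_eq_iff by blast
    have eq: "\<sigma> (a + b * s) = a + b * \<sigma> s" if "a \<in> \<rat>" "b \<in> \<rat>" for a b
      using \<sigma>(1)[OF Rats_K[OF that(2)] s_K] \<sigma>(2)[OF Rats_K[OF that(1)] K_mult(1)[OF Rats_K[OF that(2)] s_K]]
        rat that by simp
    show "\<sigma> \<in> {restrict (\<lambda>x. x) K, restrict galois K}"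
      using ss
    proof
      assume s: "\<sigma> s = s"
      have "\<sigma> = restrict (\<lambda>x. x) K"
        by (rule extensionalityI[OF ext]) (auto elim!: K_E simp: eq s K_I)
      thus ?thesis by simp
    next
      assume s: "\<sigma> s = - s"
      have "\<sigma> = restrict galois K"
        by (rule extensionalityI[OF ext]) (auto elim!: K_E simp: eq s K_I galois_coords)
      thus ?thesis by simp
    qed
  next
    fix \<sigma> assume "\<sigma> \<in> {restrict (\<lambda>x. x) K, restrict galois K}"
    thus "\<sigma> \<in> real_embeddings K"
      using 1 by (auto simp: real_embeddings_def hom K_add K_mult)
  qed
qed

lemma real_embeddings_distinct: "restrict (\<lambda>x. x) K \<noteq> restrict galois K"
proof
  assume "restrict (\<lambda>x. x) K = restrict galois K"
  hence "s = - s" using s_K by (metis galois_s restrict_apply')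
  thus False using s_irrational by simp
qed

lemma card_real_embeddings: "card (real_embeddings K) = 2"
  unfolding real_embeddings_K using real_embeddings_distinct by (rule card_2_iff[THEN iffD2, OF exI, OF exI, OF conjI, OF refl])

section \<open>Height and radical\<close>

text \<open>At the finite places every term of the height of a triple containing a unit is nonnegative,
  so the height is at least its infinite part.\<close>

lemma abc_height_ge:
  assumes "a \<in> OK" "a' \<in> OK" "a * a' = 1"
    and bc: "b \<in> K" "c \<in> K"
    and M: "M > 0" "M \<le> max \<bar>a\<bar> \<bar>b\<bar>" "M \<le> max \<bar>galois a\<bar> \<bar>galois b\<bar>"
  shows "ln M \<le> abc_height K a b c"
proof -
  note ab = OK_K[OF assms(1)] bc
  have 1: "ln M \<le> ln (Max {\<bar>\<sigma> a\<bar>, \<bar>\<sigma> b\<bar>, \<bar>\<sigma> c\<bar>})" if "\<sigma> \<in> real_embeddings K" for \<sigma>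
  proof (rule ln_mono)
    show "M \<le> Max {\<bar>\<sigma> a\<bar>, \<bar>\<sigma> b\<bar>, \<bar>\<sigma> c\<bar>}"
      using that M(2,3) ab unfolding real_embeddings_K by (auto simp: max_def split: if_splits)
  qed (use M in auto)
  have "(\<Sum>\<sigma>\<in>real_embeddings K. ln M) \<le> (\<Sum>\<sigma>\<in>real_embeddings K. ln (Max {\<bar>\<sigma> a\<bar>, \<bar>\<sigma> b\<bar>, \<bar>\<sigma> c\<bar>}))"
    by (rule sum_mono) (rule 1)
  hence A: "2 * ln M \<le> (\<Sum>\<sigma>\<in>real_embeddings K. ln (Max {\<bar>\<sigma> a\<bar>, \<bar>\<sigma> b\<bar>, \<bar>\<sigma> c\<bar>}))"
    using card_real_embeddings by simp
  have B: "0 \<le> (\<Sum>\<^sub>\<infinity>\<pp>\<in>finite_places K. ln (Max {finite_abs K \<pp> a, finite_abs K \<pp> b, finite_abs K \<pp> c}))"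
  proof (rule infsum_nonneg)
    fix \<pp> assume p: "\<pp> \<in> finite_places K"
    have "valuation K \<pp> a = 0"
      by (rule valuation_outside[OF p assms(1) unit_not_in_place[OF p assms(1-3)]])
    hence "finite_abs K \<pp> a = 1" by (simp add: finite_abs_def)
    hence "1 \<le> Max {finite_abs K \<pp> a, finite_abs K \<pp> b, finite_abs K \<pp> c}" by simp
    thus "0 \<le> ln (Max {finite_abs K \<pp> a, finite_abs K \<pp> b, finite_abs K \<pp> c})" by (rule ln_ge_zero)
  qed
  show ?thesis using A B by (simp add: abc_height_def field_degree_K)
qed

lemma places_over_disjoint:
  assumes "prime l" "prime l'" "l \<noteq> l'" shows "places_over l \<inter> places_over l' = {}"
proof (rule ccontr)
  assume "places_over l \<inter> places_over l' \<noteq> {}"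
  then obtain \<pp> where p: "\<pp> \<in> finite_places K" "real l \<in> \<pp>" "real l' \<in> \<pp>"
    by (auto simp: places_over_def)
  have "l dvd l'" using place_int_iff[OF p(1) assms(1) p(2), of "int l'"] p(3) by simp
  thus False using assms by (simp add: primes_dvd_imp_eq)
qed

text \<open>When \<open>a\<close> and \<open>b\<close> are units, the radical only sees the prime ideals containing \<open>c\<close>;
  those lie above the rational primes dividing the norm of \<open>c\<close>, and the primes above \<open>l\<close>
  contribute at most \<open>2 ln l\<close>.\<close>

lemma abc_radical_le:
  assumes "a \<in> OK" "a' \<in> OK" "a * a' = 1" "b \<in> OK" "b' \<in> OK" "b * b' = 1"
    and c: "c \<in> OK" "c * galois c = of_int m" "m \<noteq> 0"
  shows "2 * abc_radical K a b c \<le> (\<Sum>l\<in>prime_factors (nat \<bar>m\<bar>). 2 * ln (real l))"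
proof -
  let ?P = "prime_factors (nat \<bar>m\<bar>)"
  let ?f = "\<lambda>\<pp>. ln (real (ideal_norm K \<pp>))"
  have fin: "finite (\<Union>l\<in>?P. places_over l)"
    using finite_places_over by (auto simp: in_prime_factors_iff)
  have "abc_places K a b c \<subseteq> (\<Union>l\<in>?P. places_over l)"
  proof
    fix \<pp> assume "\<pp> \<in> abc_places K a b c"
    hence p: "\<pp> \<in> finite_places K" "\<not> (valuation K \<pp> a = valuation K \<pp> b \<and> valuation K \<pp> b = valuation K \<pp> c)"
      by (auto simp: abc_places_def)
    have "valuation K \<pp> a = 0" "valuation K \<pp> b = 0"
      using valuation_outside[OF p(1)] unit_not_in_place[OF p(1)] assms by blast+
    hence "c \<in> \<pp>" using valuation_outside[OF p(1) c(1)] p(2) by auto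
    then obtain l where "prime l" "int l dvd m" "real l \<in> \<pp>"
      using place_contains_norm_prime[OF p(1) _ c(2,3)] by blast
    thus "\<pp> \<in> (\<Union>l\<in>?P. places_over l)"
      using p(1) c(3) by (auto simp: places_over_def in_prime_factors_iff)
  qed
  moreover have pos: "0 \<le> ?f \<pp>" if p: "\<pp> \<in> (\<Union>l\<in>?P. places_over l)" for \<pp>
  proof -
    obtain l where "prime l" "\<pp> \<in> places_over l" using p by (auto simp: in_prime_factors_iff)
    hence "1 \<le> real (ideal_norm K \<pp>)" using ideal_norm_ge_2[of l \<pp>] by simp
    thus ?thesis by (rule ln_ge_zero)
  qed
  ultimately have "(\<Sum>\<pp>\<in>abc_places K a b c. ?f \<pp>) \<le> (\<Sum>\<pp>\<in>(\<Union>l\<in>?P. places_over l). ?f \<pp>)"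
    using fin by (intro sum_mono2) auto
  also have "\<dots> \<le> (\<Sum>l\<in>?P. \<Sum>\<pp>\<in>places_over l. ?f \<pp>)"
  proof (rule eq_refl, rule sum.UNION_disjoint)
    show "\<forall>l\<in>?P. finite (places_over l)"
      using finite_places_over by (auto simp: in_prime_factors_iff)
    show "\<forall>l\<in>?P. \<forall>l'\<in>?P. l \<noteq> l' \<longrightarrow> places_over l \<inter> places_over l' = {}"
      using places_over_disjoint by (auto simp: in_prime_factors_iff)
  qed auto
  also have "\<dots> \<le> (\<Sum>l\<in>?P. 2 * ln (real l))"
    by (rule sum_mono) (auto simp: in_prime_factors_iff intro: sum_ln_norm_places_over)
  finally show ?thesis by (simp add: abc_radical_def field_degree_K)
qed

end

section \<open>Divisibility of Lucas numbers\<close>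

lemma lucas_U_add:
  "lucas_U P Q (Suc (m + n)) = lucas_U P Q (Suc m) * lucas_U P Q (Suc n) + Q * lucas_U P Q m * lucas_U P Q n"
proof (induction P Q m rule: lucas_U.induct)
  case (3 P Q m)
  let ?U = "lucas_U P Q"
  have "?U (Suc (Suc (Suc m) + n)) = P * ?U (Suc (Suc m + n)) + Q * ?U (Suc (m + n))" by simp
  also have "\<dots> = P * (?U (Suc (Suc m)) * ?U (Suc n) + Q * ?U (Suc m) * ?U n) +
      Q * (?U (Suc m) * ?U (Suc n) + Q * ?U m * ?U n)"
    by (simp only: 3)
  also have "\<dots> = ?U (Suc (Suc (Suc m))) * ?U (Suc n) + Q * ?U (Suc (Suc m)) * ?U n"
    by (simp add: algebra_simps)
  finally show ?case .
qed simp_all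

lemma coprime_lucas_U_Suc:
  assumes "is_unit Q" shows "Rings.coprime (lucas_U P Q (Suc n)) (lucas_U P Q n)"
proof (induction n)
  case (Suc n)
  show ?case
  proof (rule coprimeI)
    fix e assume e: "e dvd lucas_U P Q (Suc (Suc n))" "e dvd lucas_U P Q (Suc n)"
    hence "e dvd lucas_U P Q (Suc (Suc n)) - P * lucas_U P Q (Suc n)" by (intro dvd_diff dvd_mult)
    hence "e dvd Q * lucas_U P Q n" by simp
    hence "e dvd lucas_U P Q n" using assms by (simp add: dvd_mult_unit_iff')
    thus "is_unit e" using e(2) Suc coprime_common_divisor by blast
  qed
qed simp

text \<open>The addition formula and the coprimality of consecutive terms allow the Euclidean algorithm to be
  run on the indices.\<close>

lemma dvd_lucas_U_gcd:
  assumes "is_unit Q" "e dvd lucas_U P Q m" "e dvd lucas_U P Q n"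
  shows "e dvd lucas_U P Q (gcd m n)"
  using assms(2,3)
proof (induction "m + n" arbitrary: m n rule: less_induct)
  case less
  have step: "e dvd lucas_U P Q k" if "e dvd lucas_U P Q (k + n)" "e dvd lucas_U P Q n" "n > 0" for k n
  proof -
    obtain j where j: "n = Suc j" using \<open>n > 0\<close> by (cases n) auto
    have "e dvd lucas_U P Q (Suc (k + j)) - lucas_U P Q (Suc k) * lucas_U P Q (Suc j)"
      using that j by (intro dvd_diff dvd_mult) simp_all
    hence "e dvd Q * (lucas_U P Q k * lucas_U P Q j)"
      by (simp only: lucas_U_add add_diff_cancel_left' mult.assoc)
    hence "e dvd lucas_U P Q k * lucas_U P Q j" using assms(1) by (simp add: dvd_mult_unit_iff')
    moreover have "Rings.coprime e (lucas_U P Q j)"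
      using coprime_divisors[OF _ dvd_refl coprime_lucas_U_Suc[OF assms(1), of P j], of e] that(2) j by simp
    ultimately show ?thesis by (simp add: coprime_dvd_mult_left_iff)
  qed
  consider "m = 0" | "n = 0" | "m > 0" "n > 0" "m \<le> n" | "m > 0" "n > 0" "n \<le> m" by linarith
  thus ?case
  proof cases
    case 3
    have "e dvd lucas_U P Q (n - m)" using step[of "n - m" m] less.prems 3 by simp
    hence "e dvd lucas_U P Q (gcd m (n - m))" using less.hyps[of m "n - m"] less.prems 3 by simp
    thus ?thesis using 3 by (metis gcd.commute gcd_diff1_nat)
  next
    case 4
    have "e dvd lucas_U P Q (m - n)" using step[of "m - n" n] less.prems 4 by simp
    hence "e dvd lucas_U P Q (gcd (m - n) n)" using less.hyps[of "m - n" n] less.prems 4 by simp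
    thus ?thesis using 4 by (simp add: gcd_diff1_nat)
  qed (use less.prems in auto)
qed

lemma coprime_lucas_U:
  assumes "is_unit Q" "Rings.coprime m n"
  shows "Rings.coprime (lucas_U P Q m) (lucas_U P Q n)"
proof (rule coprimeI)
  fix e assume "e dvd lucas_U P Q m" "e dvd lucas_U P Q n"
  hence "e dvd lucas_U P Q (gcd m n)" by (rule dvd_lucas_U_gcd[OF assms(1)])
  thus "is_unit e" using assms(2) by (simp add: coprime_iff_gcd_eq_1)
qed

lemma lucas_U_binet:
  fixes \<alpha> \<beta> :: real
  assumes "\<alpha> + \<beta> = of_int P" "\<alpha> * \<beta> = - of_int Q"
  shows "(\<alpha> - \<beta>) * of_int (lucas_U P Q n) = \<alpha> ^ n - \<beta> ^ n"
proof -
  have Q: "of_int Q = - (\<alpha> * \<beta>)" using assms(2) by simp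
  show ?thesis
  proof (induction n rule: less_induct)
    case (less n)
    consider "n = 0" | "n = 1" | k where "n = Suc (Suc k)" by (metis One_nat_def not0_implies_Suc)
    thus ?case
    proof cases
      case 3
      have "(\<alpha> - \<beta>) * of_int (lucas_U P Q n) =
         (\<alpha> + \<beta>) * ((\<alpha> - \<beta>) * of_int (lucas_U P Q (Suc k))) - \<alpha> * \<beta> * ((\<alpha> - \<beta>) * of_int (lucas_U P Q k))"
        by (simp add: 3 assms(1)[symmetric] Q algebra_simps)
      also have "\<dots> = (\<alpha> + \<beta>) * (\<alpha> ^ Suc k - \<beta> ^ Suc k) - \<alpha> * \<beta> * (\<alpha> ^ k - \<beta> ^ k)"
        using less.IH[of "Suc k"] less.IH[of k] 3 by simp
      also have "\<dots> = \<alpha> ^ n - \<beta> ^ n" by (simp add: 3 algebra_simps)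
      finally show ?thesis .
    qed auto
  qed
qed

text \<open>A prime \<open>p\<close> that divides \<open>f i\<close> but not \<open>A\<close> divides \<open>y\<close>; hence \<open>p\<^sup>2\<close> divides the product, and
  then \<open>f i\<close>, as the other factors are prime to \<open>p\<close>.\<close>

lemma square_dvd_factor:
  fixes A y p :: int and f :: "nat \<Rightarrow> int"
  assumes eq: "A * y\<^sup>2 = (\<Prod>i<r. f i)" and cop: "\<And>j. j < r \<Longrightarrow> j \<noteq> i \<Longrightarrow> Rings.coprime (f i) (f j)"
    and i: "i < r" and p: "prime p" "p dvd f i"
  shows "p\<^sup>2 dvd A\<^sup>2 * f i"
proof (cases "p dvd A")
  case True
  thus ?thesis by (simp add: dvd_mult2)
next
  case False
  define g where "g = (\<Prod>j\<in>{..<r} - {i}. f j)"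
  have eq': "A * y\<^sup>2 = f i * g" unfolding eq g_def using i by (simp add: prod.remove)
  have "Rings.coprime p g" unfolding g_def
    by (intro prod_coprime_right coprime_divisors[OF p(2) dvd_refl] cop) auto
  hence cop: "Rings.coprime (p\<^sup>2) g" by simp
  have "p dvd A * y\<^sup>2" using eq' p(2) by simp
  hence "p dvd y" using False p(1) by (simp add: prime_dvd_mult_iff prime_dvd_power_iff)
  hence "p\<^sup>2 dvd A * y\<^sup>2" by simp
  hence "p\<^sup>2 dvd f i" using cop unfolding eq' by (simp add: coprime_dvd_mult_left_iff)
  thus ?thesis by simp
qed

lemma sum_ln_primes_le:
  assumes "finite S" "\<And>p. p \<in> S \<Longrightarrow> prime p \<and> p ^ k dvd n" "n > (0::nat)"
  shows "(\<Sum>p\<in>S. real k * ln (real p)) \<le> ln (real n)"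
proof -
  have "(\<Prod>p\<in>S. p ^ k) dvd n"
    using assms(1,2)
  proof (induction S)
    case (insert p S)
    have "Rings.coprime (p ^ k) (\<Prod>q\<in>S. q ^ k)"
    proof (rule prod_coprime_right)
      fix q assume "q \<in> S"
      hence "Rings.coprime p q" using insert by (intro primes_coprime) auto
      thus "Rings.coprime (p ^ k) (q ^ k)" by simp
    qed
    thus ?case using insert by (simp add: divides_mult)
  qed simp
  hence le: "(\<Prod>p\<in>S. p ^ k) \<le> n" using assms(3) by (rule dvd_imp_le)
  have pos: "p > 0" if "p \<in> S" for p using assms(2)[OF that] by (simp add: prime_gt_0_nat)
  have "(\<Sum>p\<in>S. real k * ln (real p)) = (\<Sum>p\<in>S. ln (real (p ^ k)))"
    using pos by (intro sum.cong) (simp_all add: ln_realpow)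
  also have "\<dots> = ln (\<Prod>p\<in>S. real (p ^ k))"
    using pos by (intro ln_prod[symmetric] assms(1)) auto
  also have "(\<Prod>p\<in>S. real (p ^ k)) = real (\<Prod>p\<in>S. p ^ k)" by simp
  also have "ln \<dots> \<le> ln (real n)"
    using le pos by (intro ln_mono) (auto intro!: prod_pos simp del: of_nat_prod)
  finally show ?thesis .
qed

text \<open>The only squares that differ by \<open>4\<close> are \<open>0\<close> and \<open>4\<close>.\<close>

lemma square_diff_4:
  fixes a b :: int assumes "a\<^sup>2 = b\<^sup>2 + 4" shows "b = 0"
proof (rule ccontr)
  assume "b \<noteq> 0"
  define x where "x = \<bar>a\<bar>" define z where "z = \<bar>b\<bar>"
  have z: "z \<ge> 1" using \<open>b \<noteq> 0\<close> by (simp add: z_def)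
  have eq: "x * x = z * z + 4" and x: "x \<ge> 0" using assms by (simp_all add: x_def z_def power2_eq_square)
  have "x > z" using eq x z by (smt (verit) mult_mono)
  then obtain k where k: "x = z + k" "k \<ge> 1" by (metis add.commute diff_add_cancel zless_imp_add1_zle le_diff_eq)
  have *: "2 * (z * k) + k * k = 4" using eq by (simp add: k algebra_simps)
  have "k < 2"
  proof (rule ccontr)
    assume "\<not> k < 2"
    hence "2 * 2 \<le> k * k" "1 * 2 \<le> z * k" using z mult_mono[of 2 k 2 k] mult_mono[of 1 z 2 k] by auto
    thus False using * by linarith
  qed
  hence "k = 1" using k by linarith
  thus False using * by presburger
qed

text \<open>For \<open>P = 0\<close> positivity of the discriminant forces \<open>Q = 1\<close>; the roots are then \<open>1\<close> and \<open>-1\<close>, with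
  the root of unity \<open>-1\<close> as their quotient.\<close>

lemma lucas_nondegenerate_imp_nonzero:
  assumes "Q = 1 \<or> Q = -1" "P\<^sup>2 + 4 * Q > 0" "lucas_nondegenerate P Q"
  shows "P \<noteq> 0"
proof
  assume "P = 0"
  hence "Q = 1" using assms by auto
  have "[:- of_int Q, - of_int P, 1:] = [:- 1, 1:] * [:- (- 1), 1 :: complex:]"
    using \<open>P = 0\<close> \<open>Q = 1\<close> by simp
  hence "\<not> root_of_unity (1 / (-1))" using assms(3) unfolding lucas_nondegenerate_def by blast
  moreover have "root_of_unity (1 / (-1))"
    unfolding root_of_unity_def by (intro exI[of _ 2]) simp
  ultimately show False by blast
qed

lemma discriminant_sqrt_irrational:
  assumes "Q = 1 \<or> Q = -1" "P\<^sup>2 + 4 * Q > (0::int)" "P \<noteq> 0"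
  shows "sqrt (of_int (P\<^sup>2 + 4 * Q)) \<notin> \<rat>"
proof
  let ?d = "P\<^sup>2 + 4 * Q"
  assume "sqrt (of_int ?d) \<in> \<rat>"
  moreover have "algebraic_int (sqrt (of_int ?d))"
    by (intro algebraic_int_sqrt int_imp_algebraic_int Ints_of_int)
  ultimately have "sqrt (of_int ?d) \<in> \<int>" using rational_algebraic_int_is_int by blast
  then obtain k where k: "sqrt (of_int ?d) = of_int k" by (elim Ints_cases)
  have "real_of_int ?d = (of_int k)\<^sup>2"
    unfolding k[symmetric] by (rule real_sqrt_pow2[symmetric]) (use assms(2) in linarith)
  hence kk: "?d = k\<^sup>2" by (metis of_int_eq_iff of_int_power)
  from assms(1) show False
  proof
    assume "Q = 1" thus False using square_diff_4[of k P] kk assms(3) by simp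
  next
    assume "Q = -1"
    hence "P\<^sup>2 = k\<^sup>2 + 4" using kk by simp
    hence "k = 0" by (rule square_diff_4)
    thus False using kk assms(2) by simp
  qed
qed

section \<open>The abc conjecture bounds the index\<close>

lemma (in real_quadratic) galois_power: "x \<in> K \<Longrightarrow> x ^ n \<in> K \<and> galois (x ^ n) = galois x ^ n"
  by (induction n) (auto simp: K_mult Rats_K)

text \<open>Granting the abc conjecture, only finitely many indices \<open>n\<close> are such that \<open>U\<^sub>n\<close> is divisible by
  the square of each of its prime factors that does not divide \<open>A\<close>.\<close>

lemma abc_lucas_square_full_bound:
  fixes P Q A :: int
  assumes Q: "Q = 1 \<or> Q = -1" and pos: "P\<^sup>2 + 4 * Q > 0" and P: "P \<noteq> 0"
    and abc: "abc_conjecture_over (quadratic_field (P\<^sup>2 + 4 * Q))" and A: "A \<noteq> 0"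
  shows "\<exists>C :: real. \<forall>n>0. (\<forall>p. prime p \<longrightarrow> p dvd lucas_U P Q n \<longrightarrow> p\<^sup>2 dvd A\<^sup>2 * lucas_U P Q n) \<longrightarrow> real n < C"
proof -
  define d where "d = P\<^sup>2 + 4 * Q"
  interpret real_quadratic d
    by unfold_locales (use pos discriminant_sqrt_irrational[OF Q pos P] in \<open>simp_all add: d_def\<close>)
  define \<alpha> where "\<alpha> = of_int P / 2 + 1 / 2 * s"
  define \<beta> where "\<beta> = of_int P / 2 - 1 / 2 * s"
  have s1: "s \<ge> 1" using d_pos by (simp add: s_def)
  have sum: "\<alpha> + \<beta> = of_int P" and diff: "\<alpha> - \<beta> = s" by (simp_all add: \<alpha>_def \<beta>_def)
  have "\<alpha> * \<beta> = (of_int P * of_int P - s * s) / 4" unfolding \<alpha>_def \<beta>_def by (simp add: field_simps)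
  moreover have "real_of_int d = of_int P * of_int P + 4 * of_int Q"
    by (simp add: d_def power2_eq_square)
  ultimately have prod: "\<alpha> * \<beta> = - of_int Q" by simp
  have QQ: "real_of_int Q * of_int Q = 1" using Q by auto
  have \<alpha>K: "\<alpha> \<in> K" unfolding \<alpha>_def by (rule K_I) auto
  have g\<alpha>: "galois \<alpha> = \<beta>" unfolding \<alpha>_def \<beta>_def by (rule galois_coords) auto
  have \<beta>K: "\<beta> \<in> K" and g\<beta>: "galois \<beta> = \<alpha>" using galois_K[OF \<alpha>K] g\<alpha> by auto
  have \<alpha>O: "\<alpha> \<in> OK" unfolding OK_iff g\<alpha> sum prod using \<alpha>K by simp
  have \<beta>O: "\<beta> \<in> OK" using galois_OK[OF \<alpha>O] g\<alpha> by simp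
  \<comment> \<open>The roots have absolute values with product \<open>1\<close>; these differ since \<open>P\<close> and \<open>s\<close> are nonzero, so the larger one
    exceeds \<open>1\<close>.\<close>
  define M where "M = max \<bar>\<alpha>\<bar> \<bar>\<beta>\<bar>"
  have abs: "\<bar>\<alpha>\<bar> * \<bar>\<beta>\<bar> = 1" using prod Q by (auto simp flip: abs_mult)
  have neq: "\<bar>\<alpha>\<bar> \<noteq> \<bar>\<beta>\<bar>"
  proof
    assume "\<bar>\<alpha>\<bar> = \<bar>\<beta>\<bar>"
    hence "\<alpha> - \<beta> = 0 \<or> \<alpha> + \<beta> = 0" by linarith
    thus False using sum diff s1 P by auto
  qed
  have M: "M > 1"
  proof (rule ccontr)
    assume "\<not> M > 1"
    hence le: "\<bar>\<alpha>\<bar> \<le> 1" "\<bar>\<beta>\<bar> \<le> 1" by (auto simp: M_def)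
    hence "\<bar>\<alpha>\<bar> < 1 \<or> \<bar>\<beta>\<bar> < 1" using neq by linarith
    moreover have "\<bar>\<alpha>\<bar> * \<bar>\<beta>\<bar> \<le> \<bar>\<alpha>\<bar>" "\<bar>\<alpha>\<bar> * \<bar>\<beta>\<bar> \<le> \<bar>\<beta>\<bar>"
      using mult_left_mono[OF le(2), of "\<bar>\<alpha>\<bar>"] mult_right_mono[OF le(1), of "\<bar>\<beta>\<bar>"] by auto
    ultimately show False using abs by linarith
  qed
  have max_pow: "M ^ n \<le> max (\<bar>\<alpha>\<bar> ^ n) (\<bar>\<beta>\<bar> ^ n)" "\<bar>\<alpha>\<bar> ^ n \<le> M ^ n" "\<bar>\<beta>\<bar> ^ n \<le> M ^ n" for n
    unfolding M_def by (auto simp: max_def intro!: power_mono)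
  obtain C where C: "\<And>a b c. a \<in> K - {0} \<Longrightarrow> b \<in> K - {0} \<Longrightarrow> c \<in> K - {0} \<Longrightarrow> a + b = c \<Longrightarrow>
      abc_height K a b c \<le> (1 + 1 / 2) * abc_radical K a b c + C"
    using abc unfolding abc_conjecture_over_def d_def
    by (metis half_gt_zero_iff zero_less_one)
  \<comment> \<open>The terms not growing with \<open>n\<close> in twice the inequality between height and radical.\<close>
  define B where "B = 3 / 2 * (2 * ln (real_of_int d) + ln (real_of_int (A\<^sup>2)) + ln 2) + 2 * C"
  have main: "real n < 2 * B / ln M + 1"
    if n: "n > 0" and sq: "\<And>p. prime p \<Longrightarrow> p dvd lucas_U P Q n \<Longrightarrow> p\<^sup>2 dvd A\<^sup>2 * lucas_U P Q n" for n
  proof -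
    define U where "U = lucas_U P Q n"
    define a where "a = \<alpha> ^ n"
    define b where "b = - (\<beta> ^ n)"
    define c where "c = s * of_int U"
    have abc_eq: "a + b = c" using lucas_U_binet[OF sum prod, of n] by (simp add: a_def b_def c_def U_def diff)
    have U0: "U \<noteq> 0"
    proof
      assume "U = 0"
      hence "\<bar>\<alpha>\<bar> ^ n = \<bar>\<beta>\<bar> ^ n" using abc_eq by (simp add: a_def b_def c_def flip: power_abs)
      thus False using neq n power_eq_imp_eq_base[of "\<bar>\<alpha>\<bar>" n "\<bar>\<beta>\<bar>"] by simp
    qed
    have aO: "a \<in> OK" and bO: "b \<in> OK" and cO: "c \<in> OK"
      unfolding a_def b_def c_def
      by (rule OK_power[OF \<alpha>O] OK_minus[OF OK_power[OF \<beta>O]] OK_mult[OF s_OK Ints_OK[OF Ints_of_int]])+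
    \<comment> \<open>The inverses of \<open>a\<close> and \<open>b\<close>, from \<open>\<alpha> \<beta> = - Q\<close> and \<open>Q\<^sup>2 = 1\<close>.\<close>
    define a' where "a' = (- of_int Q * \<beta>) ^ n"
    define b' where "b' = - ((- of_int Q * \<alpha>) ^ n)"
    have a'O: "a' \<in> OK" and b'O: "b' \<in> OK"
      unfolding a'_def b'_def
      by (rule OK_power OK_minus OK_mult \<alpha>O \<beta>O Ints_OK[OF Ints_of_int])+
    have "\<alpha> * (- of_int Q * \<beta>) = - of_int Q * (\<alpha> * \<beta>)" "\<beta> * (- of_int Q * \<alpha>) = - of_int Q * (\<alpha> * \<beta>)"
      by (simp_all add: ac_simps)
    hence "\<alpha> * (- of_int Q * \<beta>) = 1" "\<beta> * (- of_int Q * \<alpha>) = 1"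
      unfolding prod using QQ by simp_all
    hence aa: "a * a' = 1" and bb: "b * b' = 1"
      by (simp_all add: a_def a'_def b_def b'_def flip: power_mult_distrib)
    have ga: "galois a = \<beta> ^ n" and gb: "galois b = - (\<alpha> ^ n)"
      using galois_power[OF \<alpha>K, of n] galois_power[OF \<beta>K, of n] K_minus
      by (simp_all add: a_def b_def g\<alpha> g\<beta>)
    have cc: "c * galois c = of_int (- (d * U\<^sup>2))"
      unfolding c_def using K_mult(2)[OF s_K Rats_K[of "of_int U"]]
      by (simp add: power2_eq_square flip: s_square)
    have m0: "- (d * U\<^sup>2) \<noteq> 0" using U0 d_pos by simp
    have M0: "M ^ n > 0" using M by simp
    have "ln (M ^ n) \<le> abc_height K a b c"
      by (rule abc_height_ge[OF aO a'O aa OK_K[OF bO] OK_K[OF cO] M0])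
         (use max_pow(1)[of n] in \<open>simp_all add: ga gb, simp_all add: a_def b_def power_abs max.commute\<close>)
    also have "\<dots> \<le> (1 + 1 / 2) * abc_radical K a b c + C"
      using aa bb cO aO bO m0 cc abc_eq by (intro C) (auto intro: OK_K)
    finally have h: "2 * (real n * ln M) \<le> 3 / 2 * (2 * abc_radical K a b c) + 2 * C"
      using M by (simp add: ln_realpow)
    let ?S = "prime_factors (nat \<bar>- (d * U\<^sup>2)\<bar>)"
    let ?S1 = "prime_factors (nat d)" and ?S2 = "prime_factors (nat \<bar>U\<bar>)"
    have natm: "nat \<bar>- (d * U\<^sup>2)\<bar> = nat d * (nat \<bar>U\<bar>)\<^sup>2"
    proof -
      have "int (nat \<bar>- (d * U\<^sup>2)\<bar>) = int (nat d * (nat \<bar>U\<bar>)\<^sup>2)"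
        using d_pos by (simp add: abs_mult)
      thus ?thesis by (simp only: of_nat_eq_iff)
    qed
    have S: "?S = ?S1 \<union> ?S2" unfolding natm using d_pos U0
      by (auto simp: in_prime_factors_iff prime_dvd_mult_iff prime_dvd_power_iff)
    have "2 * abc_radical K a b c \<le> (\<Sum>l\<in>?S. 2 * ln (real l))"
      by (rule abc_radical_le[OF aO a'O aa bO b'O bb cO cc m0])
    also have "\<dots> \<le> (\<Sum>l\<in>?S1. 2 * ln (real l)) + (\<Sum>l\<in>?S2. 2 * ln (real l))"
      unfolding S by (subst sum_Un) (auto intro!: sum_nonneg ln_ge_zero simp: in_prime_factors_iff Suc_le_eq prime_gt_0_nat)
    also have "(\<Sum>l\<in>?S1. 2 * ln (real l)) \<le> 2 * ln (real_of_int d)"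
      using sum_ln_primes_le[of ?S1 1 "nat d"] d_pos
      by (simp add: in_prime_factors_iff flip: sum_distrib_left)
    also have "(\<Sum>l\<in>?S2. 2 * ln (real l)) \<le> ln (real (nat (A\<^sup>2 * \<bar>U\<bar>)))"
    proof -
      have "prime p \<and> p ^ 2 dvd nat (A\<^sup>2 * \<bar>U\<bar>)" if "p \<in> ?S2" for p
      proof -
        have p: "prime p" "int p dvd U" using that by (auto simp: in_prime_factors_iff)
        have "(int p)\<^sup>2 dvd \<bar>A\<^sup>2 * U\<bar>" using sq[of "int p"] p by (simp add: U_def)
        hence "(int p)\<^sup>2 dvd A\<^sup>2 * \<bar>U\<bar>" by (simp only: abs_mult abs_power2)
        hence "int (p ^ 2) dvd int (nat (A\<^sup>2 * \<bar>U\<bar>))" by simp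
        thus ?thesis using p(1) by (simp only: int_dvd_int_iff)
      qed
      moreover have "nat (A\<^sup>2 * \<bar>U\<bar>) > 0" using A U0 by simp
      ultimately show ?thesis using sum_ln_primes_le[of ?S2 2 "nat (A\<^sup>2 * \<bar>U\<bar>)"] by simp
    qed
    also have "ln (real (nat (A\<^sup>2 * \<bar>U\<bar>))) = ln (real_of_int (A\<^sup>2)) + ln \<bar>real_of_int U\<bar>"
      using A U0 by (simp add: ln_mult)
    also have "ln \<bar>real_of_int U\<bar> \<le> ln (2 * M ^ n)"
    proof (rule ln_mono)
      have "1 * \<bar>real_of_int U\<bar> \<le> s * \<bar>real_of_int U\<bar>" using s1 by (intro mult_right_mono) auto
      also have "\<dots> = \<bar>\<alpha> ^ n - \<beta> ^ n\<bar>" using abc_eq s1 by (simp add: a_def b_def c_def abs_mult)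
      also have "\<dots> \<le> \<bar>\<alpha>\<bar> ^ n + \<bar>\<beta>\<bar> ^ n" by (metis abs_triangle_ineq4 power_abs)
      also have "\<dots> \<le> 2 * M ^ n" using max_pow(2,3)[of n] by simp
      finally show "\<bar>real_of_int U\<bar> \<le> 2 * M ^ n" by simp
    qed (use U0 in auto)
    also have "ln (2 * M ^ n) = ln 2 + real n * ln M" using M by (simp add: ln_mult ln_realpow)
    finally have r: "2 * abc_radical K a b c \<le> 2 * ln (real_of_int d) + (ln (real_of_int (A\<^sup>2)) + (ln 2 + real n * ln M))"
      by simp
    have "real n * ln M \<le> 2 * B" using h r unfolding B_def by argo
    moreover have "ln M > 0" using M by simp
    ultimately have "real n \<le> 2 * B / ln M" by (simp add: pos_le_divide_eq)
    thus ?thesis by simp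
  qed
  show ?thesis by (intro exI[of _ "2 * B / ln M + 1"]) (use main in blast)
qed

theorem corollary1p3:
  fixes P Q A :: int
  assumes "Q = 1 \<or> Q = -1"
    and "P\<^sup>2 + 4 * Q > 0"
    and "lucas_nondegenerate P Q"
    and "abc_conjecture_over (quadratic_field (P\<^sup>2 + 4 * Q))"
    and "A \<noteq> 0"
  shows "(\<exists>C :: real. \<forall>r\<ge>1. \<forall>ns \<in> admissible_indices P Q A r. real (Max (set ns)) < C) \<and>
         (\<forall>r\<ge>1. finite (admissible_indices P Q A r))"
proof -
  have "P \<noteq> 0" by (rule lucas_nondegenerate_imp_nonzero[OF assms(1-3)])
  then obtain C :: real where C: "\<And>n. n > 0 \<Longrightarrow>
      (\<forall>p. prime p \<longrightarrow> p dvd lucas_U P Q n \<longrightarrow> p\<^sup>2 dvd A\<^sup>2 * lucas_U P Q n) \<Longrightarrow> real n < C"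
    using abc_lucas_square_full_bound[OF assms(1,2) _ assms(4,5)] by blast
  have unit: "is_unit Q" using assms(1) by auto
  have bound: "real (ns ! i) < C" if ns: "ns \<in> admissible_indices P Q A r" and i: "i < r" for ns r i
  proof (rule C)
    show "ns ! i > 0" using ns i by (simp add: admissible_indices_def)
    obtain y where y: "A * y\<^sup>2 = (\<Prod>i<r. lucas_U P Q (ns ! i))"
      using ns by (auto simp: admissible_indices_def)
    have "Rings.coprime (lucas_U P Q (ns ! i)) (lucas_U P Q (ns ! j))" if "j < r" "j \<noteq> i" for j
      using ns i that by (intro coprime_lucas_U[OF unit]) (auto simp: admissible_indices_def)
    thus "\<forall>p. prime p \<longrightarrow> p dvd lucas_U P Q (ns ! i) \<longrightarrow> p\<^sup>2 dvd A\<^sup>2 * lucas_U P Q (ns ! i)"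
      using square_dvd_factor[OF y _ i] by blast
  qed
  have len: "length ns = r" if "ns \<in> admissible_indices P Q A r" for ns r
    using that by (simp add: admissible_indices_def)
  have all: "real n < C" if "ns \<in> admissible_indices P Q A r" "n \<in> set ns" for ns r n
    using bound[OF that(1)] len[OF that(1)] that(2) by (metis in_set_conv_nth)
  have "real (Max (set ns)) < C" if "r \<ge> 1" "ns \<in> admissible_indices P Q A r" for r ns
  proof -
    have "set ns \<noteq> {}" using that len by fastforce
    hence "Max (set ns) \<in> set ns" by simp
    thus ?thesis using all that(2) by blast
  qed
  moreover have "finite (admissible_indices P Q A r)" for r
  proof (rule finite_subset)
    show "admissible_indices P Q A r \<subseteq> {ns. set ns \<subseteq> {..nat \<lceil>C\<rceil>} \<and> length ns = r}"
    proof safe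
      fix ns n assume "ns \<in> admissible_indices P Q A r" "n \<in> set ns"
      hence "real n < C" by (rule all)
      thus "n \<le> nat \<lceil>C\<rceil>" by linarith
    qed (rule len)
    show "finite {ns. set ns \<subseteq> {..nat \<lceil>C\<rceil>} \<and> length ns = r}"
      by (rule finite_lists_length_eq) simp
  qed
  ultimately show ?thesis by blast
qed

end
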